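(* Let $\mathcal{G}$ be a groupoid with a length function $\ell$, and let $(\mathcal{G}^{(0)},\mathcal{R},\mu)$ be a probability measure space. Then the following are equivalent: (1) $\mathcal{G}$ is asymptotically expanding in measure $\mu$. (2) $\mathcal{G}^{(0)}$ admits an exhaustion by domains of expansion with bounded ratio; that is, there are measurable sets $Y_n\subseteq\mathcal{G}^{(0)}$ ($n\in\mathbb{N}$) with $\mu(Y_n)\to 1$ and constants $C_n,N_n,L_n>0$, $\theta_n\ge 1$ such that each $Y_n$ is a domain of $(C_n,N_n,L_n)$-expansion with ratio bounded by $\theta_n$. (3) $\mathcal{G}^{(0)}$ admits an exhaustion by domains of Markov expansion with bounded ratio; that is, there are measurable sets $Y_n\subseteq\mathcal{G}^{(0)}$ ($n\in\mathbb{N}$) with $\mu(Y_n)\to 1$ and constants $C_n,N_n,L_n>0$, $\theta_n\ge 1$ such that each $Y_n$ is a domain of Markov $(C_n,N_n,L_n)$-expansion with ratio bounded by $\theta_n$.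
   Context: Groupoids. A groupoid $\mathcal{G}$ (no topology assumed) has unit space $\mathcal{G}^{(0)}\subseteq\mathcal{G}$ and source and range maps $\mathrm{s},\mathrm{r}:\mathcal{G}\to\mathcal{G}^{(0)}$; $\gamma_1\gamma_2$ is defined when $\mathrm{s}(\gamma_1)=\mathrm{r}(\gamma_2)$. For $K\subseteq\mathcal{G}$ put $K^{-1}=\{\gamma^{-1}:\gamma\in K\}$, and for $A,B\subseteq\mathcal{G}$ put $A\cdot B=\{\gamma_1\gamma_2:\gamma_1\in A,\gamma_2\in B,\mathrm{s}(\gamma_1)=\mathrm{r}(\gamma_2)\}$. In particular for $A\subseteq\mathcal{G}^{(0)}$, $\mathrm{r}(K\cdot A)=\{\mathrm{r}(\gamma):\gamma\in K,\mathrm{s}(\gamma)\in A\}$. $K$ is symmetric if $K=K^{-1}$, unital if $\mathcal{G}^{(0)}\subseteq K$, and a bisection if $\mathrm{s}|_K,\mathrm{r}|_K$ are injective; then $\tau_K:=\mathrm{r}|_K\circ(\mathrm{s}|_K)^{-1}:\mathrm{s}(K)\to\mathrm{r}(K)$. A length function is a map $\ell:\mathcal{G}\to[0,\infty)$ with $\ell=0$ on $\mathcal{G}^{(0)}$, $\ell(\gamma^{-1})=\ell(\gamma)$, and $\ell(\gamma_1\gamma_2)\le\ell(\gamma_1)+\ell(\gamma_2)$ for composable pairs; $\ell(K):=\sup_{\gamma\in K}\ell(\gamma)$. A bisection $K$ is admissible if $\mathrm{s}(K),\mathrm{r}(K)\in\mathcal{R}$, $\tau_K$ is a measurable isomorphism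 preserving the measure class of $\mu$ (it and its inverse send $\mu$-null sets to $\mu$-null sets), and $\ell(K)<\infty$. A subset $K\subseteq\mathcal{G}$ is decomposable if it is a finite union of admissible bisections. For a unital symmetric decomposable $K$, a decomposition $K=\bigcup_{i=1}^N K_i$ into admissible bisections is unital if some $K_i=\mathcal{G}^{(0)}$, and symmetric if there is a bijection $\sigma$ of $\{1,\dots,N\}$ with $K_i^{-1}=K_{\sigma(i)}$. $K$ is $N$-decomposable if it has a unital symmetric decomposition into $N$ admissible bisections. $\mathcal{G}$ is asymptotically expanding in measure $\mu$ if for every $\alpha\in(0,\frac12]$ there are $C_\alpha,N_\alpha,L_\alpha>0$ and a unital symmetric $N_\alpha$-decomposable $K_\alpha\subseteq\mathcal{G}$ with $\ell(K_\alpha)\le L_\alpha$ such that $\mu(\mathrm{r}(K_\alpha\cdot A)\setminus A)>C_\alpha\mu(A)$ for all $A\in\mathcal{R}$ with $\alpha\le\mu(A)\le\frac12$. For an admissible bisection $K$ and $x\in\mathrm{s}(K)$, $\mathfrak{R}(K,x):=\frac{d(\tau_K^{-1})_*\mu|_{\mathrm{r}(K)}}{d\mu|_{\mathrm{s}(K)}}(x)$ is the Radon–Nikodym derivative (defined up to null sets; a positive finite version is chosen, and pointwise conditions on it are understood up to null sets), where $((\tau_K^{-1})_*\mu|_{\mathrm{r}(K)})(A)=\mu(\tau_K(A))$. Bounded ratio: for measurable $Y$, a decomposition $K=\bigcup_{i=1}^N K_i$ has ratio bounded by $\theta\ge1$ (on $Y$) if $\frac1\theta\le\mathfrak{R}(K_i,x)\le\theta$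 for all $x\in Y$ and all $i$ with $x\in\mathrm{s}(K_i)$ and $\tau_{K_i}(x)\in Y$. A measurable $Y\subseteq\mathcal{G}^{(0)}$ is a domain of $(C,N,L)$-expansion with ratio bounded by $\theta$ if there is a unital symmetric $N$-decomposable $K$ with $\ell(K)\le L$ and a unital symmetric decomposition $K=\bigcup_{i=1}^N K_i$ into admissible bisections, with ratio bounded by $\theta$ on $Y$, such that $\mu((\mathrm{r}(K\cdot A)\setminus A)\cap Y)>C\mu(A)$ for all measurable $A\subseteq Y$ with $0<\mu(A)\le\frac12\mu(Y)$. Markov kernels. For measurable $Y$, a unital symmetric decomposable $K$ with unital symmetric decomposition $K=\bigcup_{i=1}^N K_i$, and $x\in Y$, put $K_{Y,x}=\{i: x\in\mathrm{s}(K_i),\tau_{K_i}(x)\in Y\}$, $\sigma_{Y,K}(x)=\sum_{i\in K_{Y,x}}\mathfrak{R}(K_i,x)^{1/2}$. The normalized local Markov kernel on $Y$ is $\Pi_{Y,K}(x,\cdot)=\frac{1}{\sigma_{Y,K}(x)}\sum_{i\in K_{Y,x}}\mathfrak{R}(K_i,x)^{1/2}\delta_{\tau_{K_i}(x)}(\cdot)$, with reversing measure $d\tilde\mu_{Y,K}=\sigma_{Y,K}\,d(\mu|_Y)$. The Cheeger constant of a reversible Markov kernel $\Pi$ on a finite measure space $(Y,m)$ is $\inf\{\frac{1}{m(A)}\int_A\Pi(x,Y\setminus A)\,dm(x): A\subseteq Y \text{ measurable},\,0<m(A)\le\frac12 m(Y)\}$. $Y$ is a domain of Markov $(C,N,L)$-expansion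 with ratio bounded by $\theta$ if there is a unital symmetric $N$-decomposable $K$ with $\ell(K)\le L$ and a unital symmetric decomposition $K=\bigcup_{i=1}^N K_i$, with ratio bounded by $\theta$ on $Y$, such that $\Pi_{Y,K}$ on $(Y,\tilde\mu_{Y,K})$ has Cheeger constant greater than $C$. *)

theory Defs
  imports "HOL-Probability.Probability"
begin

record 'g groupoid =
  arrows :: "'g set"
  units :: "'g set"
  src :: "'g \<Rightarrow> 'g"
  rng :: "'g \<Rightarrow> 'g"
  gmult :: "'g \<Rightarrow> 'g \<Rightarrow> 'g"
  ginv :: "'g \<Rightarrow> 'g"

text \<open>The product \<open>gmult G a b\<close> is meaningful only when \<open>src G a = rng G b\<close>.\<close>

locale groupoid =
  fixes G :: "'g groupoid"
  assumes units_subset: "units G \<subseteq> arrows G"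
    and src_in_units: "a \<in> arrows G \<Longrightarrow> src G a \<in> units G"
    and rng_in_units: "a \<in> arrows G \<Longrightarrow> rng G a \<in> units G"
    and src_unit: "u \<in> units G \<Longrightarrow> src G u = u"
    and rng_unit: "u \<in> units G \<Longrightarrow> rng G u = u"
    and gmult_closed: "a \<in> arrows G \<Longrightarrow> b \<in> arrows G \<Longrightarrow> src G a = rng G b \<Longrightarrow> gmult G a b \<in> arrows G"
    and src_gmult: "a \<in> arrows G \<Longrightarrow> b \<in> arrows G \<Longrightarrow> src G a = rng G b \<Longrightarrow> src G (gmult G a b) = src G b"
    and rng_gmult: "a \<in> arrows G \<Longrightarrow> b \<in> arrows G \<Longrightarrow> src G a = rng G b \<Longrightarrow> rng G (gmult G a b) = rng G a"
    and gmult_assoc: "a \<in> arrows G \<Longrightarrow> b \<in> arrows G \<Longrightarrow> c \<in> arrows G \<Longrightarrow>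
      src G a = rng G b \<Longrightarrow> src G b = rng G c \<Longrightarrow>
      gmult G (gmult G a b) c = gmult G a (gmult G b c)"
    and gmult_src: "a \<in> arrows G \<Longrightarrow> gmult G a (src G a) = a"
    and rng_gmult_left: "a \<in> arrows G \<Longrightarrow> gmult G (rng G a) a = a"
    and ginv_closed: "a \<in> arrows G \<Longrightarrow> ginv G a \<in> arrows G"
    and src_ginv: "a \<in> arrows G \<Longrightarrow> src G (ginv G a) = rng G a"
    and rng_ginv: "a \<in> arrows G \<Longrightarrow> rng G (ginv G a) = src G a"
    and ginv_left: "a \<in> arrows G \<Longrightarrow> gmult G (ginv G a) a = src G a"
    and ginv_right: "a \<in> arrows G \<Longrightarrow> gmult G a (ginv G a) = rng G a"

definition set_gmult :: "'g groupoid \<Rightarrow> 'g set \<Rightarrow> 'g set \<Rightarrow> 'g set" where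
  "set_gmult G A B = {gmult G a b | a b. a \<in> A \<and> b \<in> B \<and> src G a = rng G b}"

definition symmetric :: "'g groupoid \<Rightarrow> 'g set \<Rightarrow> bool" where
  "symmetric G K \<longleftrightarrow> ginv G ` K = K"

definition unital :: "'g groupoid \<Rightarrow> 'g set \<Rightarrow> bool" where
  "unital G K \<longleftrightarrow> units G \<subseteq> K"

definition bisection :: "'g groupoid \<Rightarrow> 'g set \<Rightarrow> bool" where
  "bisection G K \<longleftrightarrow> K \<subseteq> arrows G \<and> inj_on (src G) K \<and> inj_on (rng G) K"

text \<open>For a bisection \<open>K\<close>, \<open>tau G K\<close> is meaningful on \<open>src G ` K\<close> and \<open>tau_inv G K\<close> on
  \<open>rng G ` K\<close>.\<close>

definition tau :: "'g groupoid \<Rightarrow> 'g set \<Rightarrow> 'g \<Rightarrow> 'g" where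
  "tau G K x = rng G (inv_into K (src G) x)"

definition tau_inv :: "'g groupoid \<Rightarrow> 'g set \<Rightarrow> 'g \<Rightarrow> 'g" where
  "tau_inv G K = inv_into (src G ` K) (tau G K)"

definition length_function :: "'g groupoid \<Rightarrow> ('g \<Rightarrow> real) \<Rightarrow> bool" where
  "length_function G l \<longleftrightarrow>
    (\<forall>a\<in>arrows G. 0 \<le> l a) \<and>
    (\<forall>u\<in>units G. l u = 0) \<and>
    (\<forall>a\<in>arrows G. l (ginv G a) = l a) \<and>
    (\<forall>a\<in>arrows G. \<forall>b\<in>arrows G. src G a = rng G b \<longrightarrow> l (gmult G a b) \<le> l a + l b)"

definition set_length :: "('g \<Rightarrow> real) \<Rightarrow> 'g set \<Rightarrow> ennreal" where
  "set_length l K = (SUP a\<in>K. ennreal (l a))"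

text \<open>Throughout, \<open>M\<close> is a measure with \<open>space M = units G\<close>.\<close>

definition admissible :: "'g groupoid \<Rightarrow> ('g \<Rightarrow> real) \<Rightarrow> 'g measure \<Rightarrow> 'g set \<Rightarrow> bool" where
  "admissible G l M K \<longleftrightarrow>
    bisection G K \<and>
    src G ` K \<in> sets M \<and> rng G ` K \<in> sets M \<and>
    tau G K \<in> restrict_space M (src G ` K) \<rightarrow>\<^sub>M restrict_space M (rng G ` K) \<and>
    tau_inv G K \<in> restrict_space M (rng G ` K) \<rightarrow>\<^sub>M restrict_space M (src G ` K) \<and>
    (\<forall>A\<in>null_sets M. A \<subseteq> src G ` K \<longrightarrow> tau G K ` A \<in> null_sets M) \<and>
    (\<forall>B\<in>null_sets M. B \<subseteq> rng G ` K \<longrightarrow> tau_inv G K ` B \<in> null_sets M) \<and>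
    set_length l K < \<infinity>"

definition decomposable :: "'g groupoid \<Rightarrow> ('g \<Rightarrow> real) \<Rightarrow> 'g measure \<Rightarrow> 'g set \<Rightarrow> bool" where
  "decomposable G l M K \<longleftrightarrow> (\<exists>F. finite F \<and> (\<forall>B\<in>F. admissible G l M B) \<and> K = \<Union>F)"

text \<open>Decompositions are families indexed by \<open>{1..N}\<close>; repetitions and overlaps are allowed.\<close>

definition decomposition ::
  "'g groupoid \<Rightarrow> ('g \<Rightarrow> real) \<Rightarrow> 'g measure \<Rightarrow> nat \<Rightarrow> 'g set \<Rightarrow> (nat \<Rightarrow> 'g set) \<Rightarrow> bool" where
  "decomposition G l M N K Ks \<longleftrightarrow>
    (\<forall>i\<in>{1..N}. admissible G l M (Ks i)) \<and> K = (\<Union>i\<in>{1..N}. Ks i)"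

definition unital_decomp :: "'g groupoid \<Rightarrow> nat \<Rightarrow> (nat \<Rightarrow> 'g set) \<Rightarrow> bool" where
  "unital_decomp G N Ks \<longleftrightarrow> (\<exists>i\<in>{1..N}. Ks i = units G)"

definition symmetric_decomp :: "'g groupoid \<Rightarrow> nat \<Rightarrow> (nat \<Rightarrow> 'g set) \<Rightarrow> bool" where
  "symmetric_decomp G N Ks \<longleftrightarrow>
    (\<exists>\<sigma>. bij_betw \<sigma> {1..N} {1..N} \<and> (\<forall>i\<in>{1..N}. ginv G ` Ks i = Ks (\<sigma> i)))"

definition unital_symmetric_decomposition ::
  "'g groupoid \<Rightarrow> ('g \<Rightarrow> real) \<Rightarrow> 'g measure \<Rightarrow> nat \<Rightarrow> 'g set \<Rightarrow> (nat \<Rightarrow> 'g set) \<Rightarrow> bool" where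
  "unital_symmetric_decomposition G l M N K Ks \<longleftrightarrow>
    decomposition G l M N K Ks \<and> unital_decomp G N Ks \<and> symmetric_decomp G N Ks"

definition n_decomposable ::
  "'g groupoid \<Rightarrow> ('g \<Rightarrow> real) \<Rightarrow> 'g measure \<Rightarrow> nat \<Rightarrow> 'g set \<Rightarrow> bool" where
  "n_decomposable G l M N K \<longleftrightarrow>
    unital G K \<and> symmetric G K \<and> decomposable G l M K \<and>
    (\<exists>Ks. unital_symmetric_decomposition G l M N K Ks)"

definition asymptotically_expanding ::
  "'g groupoid \<Rightarrow> ('g \<Rightarrow> real) \<Rightarrow> 'g measure \<Rightarrow> bool" where
  "asymptotically_expanding G l M \<longleftrightarrow>
    (\<forall>\<alpha>::real. 0 < \<alpha> \<and> \<alpha> \<le> 1/2 \<longrightarrow>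
      (\<exists>(C::real) (N::nat) (L::real) K. C > 0 \<and> N > 0 \<and> L > 0 \<and>
        n_decomposable G l M N K \<and> set_length l K \<le> ennreal L \<and>
        (\<forall>A\<in>sets M. \<alpha> \<le> measure M A \<and> measure M A \<le> 1/2 \<longrightarrow>
          measure M (rng G ` set_gmult G K A - A) > C * measure M A)))"

text \<open>The library version of the Radon--Nikodym derivative takes values in \<open>[0, \<infinity>]\<close>. For
  admissible \<open>K\<close> the two measures are equivalent and finite, so the derivative is positive and finite
  almost everywhere; resetting the exceptional values to \<open>1\<close> gives a positive finite version.\<close>

definition RN_ratio :: "'g groupoid \<Rightarrow> 'g measure \<Rightarrow> 'g set \<Rightarrow> 'g \<Rightarrow> real" where
  "RN_ratio G M K x =
    (let d = RN_deriv (restrict_space M (src G ` K))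
               (distr (restrict_space M (rng G ` K)) (restrict_space M (src G ` K)) (tau_inv G K)) x
     in if 0 < d \<and> d < \<infinity> then enn2real d else 1)"

definition ratio_bounded ::
  "'g groupoid \<Rightarrow> 'g measure \<Rightarrow> nat \<Rightarrow> (nat \<Rightarrow> 'g set) \<Rightarrow> 'g set \<Rightarrow> real \<Rightarrow> bool" where
  "ratio_bounded G M N Ks Y \<theta> \<longleftrightarrow>
    (AE x in M. \<forall>i\<in>{1..N}. x \<in> Y \<and> x \<in> src G ` Ks i \<and> tau G (Ks i) x \<in> Y \<longrightarrow>
      1 / \<theta> \<le> RN_ratio G M (Ks i) x \<and> RN_ratio G M (Ks i) x \<le> \<theta>)"

definition domain_of_expansion ::
  "'g groupoid \<Rightarrow> ('g \<Rightarrow> real) \<Rightarrow> 'g measure \<Rightarrow> 'g set \<Rightarrow> real \<Rightarrow> nat \<Rightarrow> real \<Rightarrow> real \<Rightarrow> bool" where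
  "domain_of_expansion G l M Y C N L \<theta> \<longleftrightarrow>
    Y \<in> sets M \<and>
    (\<exists>K Ks. n_decomposable G l M N K \<and> set_length l K \<le> ennreal L \<and>
      unital_symmetric_decomposition G l M N K Ks \<and> ratio_bounded G M N Ks Y \<theta> \<and>
      (\<forall>A\<in>sets M. A \<subseteq> Y \<and> 0 < measure M A \<and> measure M A \<le> 1/2 * measure M Y \<longrightarrow>
        measure M ((rng G ` set_gmult G K A - A) \<inter> Y) > C * measure M A))"

definition local_indices ::
  "'g groupoid \<Rightarrow> nat \<Rightarrow> (nat \<Rightarrow> 'g set) \<Rightarrow> 'g set \<Rightarrow> 'g \<Rightarrow> nat set" where
  "local_indices G N Ks Y x = {i\<in>{1..N}. x \<in> src G ` Ks i \<and> tau G (Ks i) x \<in> Y}"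

definition local_weight ::
  "'g groupoid \<Rightarrow> 'g measure \<Rightarrow> nat \<Rightarrow> (nat \<Rightarrow> 'g set) \<Rightarrow> 'g set \<Rightarrow> 'g \<Rightarrow> real" where
  "local_weight G M N Ks Y x = (\<Sum>i\<in>local_indices G N Ks Y x. sqrt (RN_ratio G M (Ks i) x))"

text \<open>The Dirac mass at \<open>y\<close> evaluated at a set \<open>B\<close> is \<open>indicator B y\<close>.\<close>

definition markov_kernel ::
  "'g groupoid \<Rightarrow> 'g measure \<Rightarrow> nat \<Rightarrow> (nat \<Rightarrow> 'g set) \<Rightarrow> 'g set \<Rightarrow> 'g \<Rightarrow> 'g set \<Rightarrow> ennreal" where
  "markov_kernel G M N Ks Y x B =
    ennreal (1 / local_weight G M N Ks Y x *
      (\<Sum>i\<in>local_indices G N Ks Y x. sqrt (RN_ratio G M (Ks i) x) * indicator B (tau G (Ks i) x)))"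

definition reversing_measure ::
  "'g groupoid \<Rightarrow> 'g measure \<Rightarrow> nat \<Rightarrow> (nat \<Rightarrow> 'g set) \<Rightarrow> 'g set \<Rightarrow> 'g measure" where
  "reversing_measure G M N Ks Y =
    density (restrict_space M Y) (\<lambda>x. ennreal (local_weight G M N Ks Y x))"

text \<open>The infimum is taken in \<open>[0, \<infinity>]\<close>, so it is \<open>\<infinity>\<close> when no set qualifies.\<close>

definition cheeger_constant :: "'a measure \<Rightarrow> ('a \<Rightarrow> 'a set \<Rightarrow> ennreal) \<Rightarrow> ennreal" where
  "cheeger_constant m P =
    (INF A\<in>{A\<in>sets m. 0 < emeasure m A \<and> emeasure m A \<le> 1/2 * emeasure m (space m)}.
      1 / emeasure m A * (\<integral>\<^sup>+x\<in>A. P x (space m - A) \<partial>m))"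

definition domain_of_markov_expansion ::
  "'g groupoid \<Rightarrow> ('g \<Rightarrow> real) \<Rightarrow> 'g measure \<Rightarrow> 'g set \<Rightarrow> real \<Rightarrow> nat \<Rightarrow> real \<Rightarrow> real \<Rightarrow> bool" where
  "domain_of_markov_expansion G l M Y C N L \<theta> \<longleftrightarrow>
    Y \<in> sets M \<and>
    (\<exists>K Ks. n_decomposable G l M N K \<and> set_length l K \<le> ennreal L \<and>
      unital_symmetric_decomposition G l M N K Ks \<and> ratio_bounded G M N Ks Y \<theta> \<and>
      cheeger_constant (reversing_measure G M N Ks Y) (markov_kernel G M N Ks Y) > ennreal C)"

end

theory Submission
  imports Defs
begin

text \<open>
  A decomposition \<open>K = K\<^sub>1 \<union> \<dots> \<union> K\<^sub>N\<close> acts on the unit space only through the partial maps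
  \<open>\<tau>\<^sub>i\<close> and their Radon--Nikodym derivatives \<open>R\<^sub>i\<close>, because \<open>r(K \<cdot> A)\<close> is the union of the images
  \<open>\<tau>\<^sub>i(A \<inter> s(K\<^sub>i))\<close>. All the analysis therefore takes place in the locale
  \<open>partial_transports\<close>: a probability space with a finite family of partial maps with densities
  that is closed under inverses and contains the identity.

  One estimate is used everywhere. Write \<open>\<partial>A = (r(K \<cdot> A) - A) \<inter> Y\<close> for \<open>A \<subseteq> Y\<close>. An arrow from
  \<open>Y - A\<close> into \<open>A\<close> is the inverse of an arrow from \<open>A\<close> into \<open>Y - A\<close>, so if the ratios are bounded
  by \<open>\<theta>\<close> on \<open>Y\<close>, then \<open>\<mu>(\<partial>(Y - A)) \<le> N \<theta> \<mu>(\<partial>A)\<close> (\<open>boundary_complement_le\<close>). A set that fills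
  more than half of the space can thus be replaced by its complement, which may be assumed to expand.

  \<^item> Asymptotic expansion gives domains (\<open>exists_expanding_subset\<close>). First discard a small set on
    which some \<open>R\<^sub>i\<close> is very large or very small. In the remaining set \<open>X\<close> every set of measure
    between \<open>\<alpha>\<close> and \<open>1/2\<close> still expands, so the sets of measure at most \<open>1/2\<close> that expand
    badly have measure below \<open>\<alpha>\<close>. Remove a maximal one, \<open>A\<close>. If some \<open>B \<subseteq> X - A\<close> expanded badly, then so would \<open>A \<union> B\<close>; either
    this contradicts maximality, or \<open>A \<union> B\<close> has measure above \<open>1/2\<close> and its complement in \<open>X\<close>
    contradicts the expansion of sets of medium size.

  \<^item> Domains give asymptotic expansion (\<open>expands_imp_reach_gt\<close>). If \<open>Y\<close> nearly has full measure,
    then a set \<open>A\<close> of measure at least \<open>\<alpha>\<close> keeps half of its measure inside \<open>Y\<close>, and either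
    \<open>A \<inter> Y\<close> or its complement in \<open>Y\<close> is small enough for the expansion of \<open>Y\<close> to apply.

  \<^item> Expansion and Markov expansion of the same \<open>Y\<close> are equivalent
    (\<open>expands_imp_markov_expands\<close>, \<open>markov_expands_imp_expands\<close>). With bounded ratio the weight
    \<open>\<sigma>\<close> lies between \<open>1/\<theta>\<close> and \<open>N \<theta>\<close>, the flow \<open>\<integral>\<^sub>A \<Pi>(x, Y - A)\<close> is comparable to \<open>\<mu>(\<partial>A)\<close>, and
    a set that fills at most half of \<open>Y\<close> for only one of the two measures is handled by passing to
    its complement.
\<close>

section \<open>The partial map of an admissible bisection\<close>

lemma tau_src:
  assumes "bisection G K" and "a \<in> K"
  shows "tau G K (src G a) = rng G a"
  using assms by (simp add: bisection_def tau_def)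

lemma tau_image:
  assumes "bisection G K"
  shows "tau G K ` src G ` K = rng G ` K"
  using tau_src[OF assms] by (force simp: image_image)

lemma inj_on_tau:
  assumes "bisection G K"
  shows "inj_on (tau G K) (src G ` K)"
proof (rule inj_onI)
  fix x y assume "x \<in> src G ` K" "y \<in> src G ` K" and eq: "tau G K x = tau G K y"
  then obtain a b where ab: "a \<in> K" "x = src G a" "b \<in> K" "y = src G b" by auto
  with eq tau_src[OF assms] have "rng G a = rng G b" by simp
  with ab assms show "x = y" by (auto simp: bisection_def inj_on_def)
qed

lemma tau_inv_tau:
  assumes "bisection G K" and "x \<in> src G ` K"
  shows "tau_inv G K (tau G K x) = x"
  unfolding tau_inv_def using inj_on_tau[OF assms(1)] assms(2) by (rule inv_into_f_f)

lemma tau_inv_vimage: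
  assumes "bisection G K" and "S \<subseteq> src G ` K"
  shows "tau_inv G K -` S \<inter> rng G ` K = tau G K ` S"
proof -
  have "rng G ` K = tau G K ` (src G ` K)" using tau_image[OF assms(1)] by simp
  then show ?thesis using tau_inv_tau[OF assms(1)] assms(2) by auto
qed

lemma RN_ratio_pos: "0 < RN_ratio G M K x"
  by (auto simp: RN_ratio_def Let_def enn2real_positive_iff less_top)

lemma sets_vimage_tau:
  assumes "admissible G l M K" and "B \<in> sets M"
  shows "{x \<in> src G ` K. tau G K x \<in> B} \<in> sets M"
proof -
  have K: "bisection G K" "src G ` K \<in> sets M" "rng G ` K \<in> sets M"
      "tau G K \<in> restrict_space M (src G ` K) \<rightarrow>\<^sub>M restrict_space M (rng G ` K)"
    using assms(1) by (auto simp: admissible_def)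
  have "B \<inter> rng G ` K \<in> sets (restrict_space M (rng G ` K))"
    using K(3) assms(2) by (auto simp: sets_restrict_space_iff)
  from measurable_sets[OF K(4) this]
  have "tau G K -` (B \<inter> rng G ` K) \<inter> src G ` K \<in> sets M"
    using K(2) sets.sets_into_space[OF K(2)]
    by (simp add: sets_restrict_space_iff space_restrict_space Int_absorb1 Int_absorb2)
  also have "tau G K -` (B \<inter> rng G ` K) \<inter> src G ` K = {x \<in> src G ` K. tau G K x \<in> B}"
    using tau_image[OF K(1)] by auto
  finally show ?thesis .
qed

lemma tau_image_sets:
  assumes "admissible G l M K" and "S \<in> sets M" and "S \<subseteq> src G ` K"
  shows "tau G K ` S \<in> sets M"
proof -
  have K: "bisection G K" "src G ` K \<in> sets M" "rng G ` K \<in> sets M"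
      "tau_inv G K \<in> restrict_space M (rng G ` K) \<rightarrow>\<^sub>M restrict_space M (src G ` K)"
    using assms(1) by (auto simp: admissible_def)
  have "S \<in> sets (restrict_space M (src G ` K))"
    using K(2) assms(2,3) by (auto simp: sets_restrict_space_iff)
  from measurable_sets[OF K(4) this]
  have "tau_inv G K -` S \<inter> rng G ` K \<in> sets M"
    using K(3) sets.sets_into_space[OF K(3)]
    by (simp add: sets_restrict_space_iff space_restrict_space Int_absorb1 Int_absorb2)
  then show ?thesis using tau_inv_vimage[OF K(1) assms(3)] by simp
qed

text \<open>
  The derivative comes from the Radon--Nikodym theorem on \<open>s(K)\<close>. There it is finite almost
  everywhere because \<open>\<mu>\<close> is finite, and nonzero almost everywhere because \<open>\<tau>\<^sup>-\<^sup>1\<close> preserves null sets: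
  the zero set of the derivative has a null image under \<open>\<tau>\<close>. Hence \<open>RN_ratio\<close>, which alters the
  derivative only at the values \<open>0\<close> and \<open>\<infinity>\<close>, represents the same measure.
\<close>

lemma RN_ratio_measurable_and_integral:
  assumes "finite_measure M" and adm: "admissible G l M K"
  shows "RN_ratio G M K \<in> borel_measurable (restrict_space M (src G ` K))"
    and "S \<in> sets M \<Longrightarrow> S \<subseteq> src G ` K \<Longrightarrow>
      emeasure M (tau G K ` S) = (\<integral>\<^sup>+x\<in>S. ennreal (RN_ratio G M K x) \<partial>M)"
proof -
  interpret finite_measure M by fact
  define A where "A = src G ` K"
  define B where "B = rng G ` K"
  define P where "P = restrict_space M A"
  define Q where "Q = distr (restrict_space M B) P (tau_inv G K)"
  define d where "d = RN_deriv P Q"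
  have K: "bisection G K" "A \<in> sets M" "B \<in> sets M"
      "tau_inv G K \<in> restrict_space M B \<rightarrow>\<^sub>M P"
    and null: "\<And>Z. Z \<in> null_sets M \<Longrightarrow> Z \<subseteq> A \<Longrightarrow> tau G K ` Z \<in> null_sets M"
    and null': "\<And>Z. Z \<in> null_sets M \<Longrightarrow> Z \<subseteq> B \<Longrightarrow> tau_inv G K ` Z \<in> null_sets M"
    using adm by (auto simp: admissible_def A_def B_def P_def)
  have R: "RN_ratio G M K x = (if 0 < d x \<and> d x < \<infinity> then enn2real (d x) else 1)" for x
    by (simp add: RN_ratio_def d_def Q_def P_def A_def B_def Let_def)
  have tauB: "tau G K ` Z \<subseteq> B" if "Z \<subseteq> A" for Z
    using image_mono[OF that, of "tau G K"] tau_image[OF K(1)] by (simp add: A_def B_def)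
  have spP: "space P = A" and setsP: "\<And>Z. Z \<in> sets P \<longleftrightarrow> Z \<in> sets M \<and> Z \<subseteq> A"
    using K(2) sets.sets_into_space[OF K(2)]
    by (auto simp: P_def space_restrict_space sets_restrict_space_iff Int_absorb1)
  have spB: "space (restrict_space M B) = B"
    using sets.sets_into_space[OF K(3)] by (auto simp: space_restrict_space)
  interpret P: finite_measure P
    unfolding P_def using finite_measure_axioms K(2) by (intro finite_measure_restrict_space) auto
  interpret RB: finite_measure "restrict_space M B"
    using finite_measure_axioms K(3) by (intro finite_measure_restrict_space) auto
  interpret Q: finite_measure Q
    unfolding Q_def using K(4) by (rule RB.finite_measure_distr)
  have sQ: "sets Q = sets P" by (simp add: Q_def)
  have emQ: "emeasure Q Z = emeasure M (tau G K ` Z)" if "Z \<in> sets P" for Z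
  proof -
    have "emeasure Q Z = emeasure (restrict_space M B) (tau_inv G K -` Z \<inter> B)"
      using that K(4) by (simp add: Q_def emeasure_distr spB)
    also have "tau_inv G K -` Z \<inter> B = tau G K ` Z"
      using tau_inv_vimage[OF K(1)] that setsP by (auto simp: A_def B_def)
    also have "emeasure (restrict_space M B) (tau G K ` Z) = emeasure M (tau G K ` Z)"
      using K(3) tauB that setsP by (simp add: emeasure_restrict_space)
    finally show ?thesis .
  qed
  have emP: "emeasure P Z = emeasure M Z" if "Z \<in> sets P" for Z
    using that K(2) setsP by (simp add: P_def emeasure_restrict_space)
  have ac: "absolutely_continuous P Q"
  proof -
    have "Z \<in> null_sets Q" if "Z \<in> null_sets P" for Z
    proof -
      have Z: "Z \<in> sets P" "Z \<in> null_sets M" "Z \<subseteq> A"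
        using that emP[of Z] setsP[of Z] by (simp_all add: null_sets_def)
      with null emQ show ?thesis by (simp add: null_sets_def sQ)
    qed
    then show ?thesis by (auto simp: absolutely_continuous_def)
  qed
  have dens: "density P d = Q"
    unfolding d_def by (rule P.density_RN_deriv[OF ac sQ])
  have dm: "d \<in> borel_measurable P" by (simp add: d_def)
  have emd: "emeasure Q Z = (\<integral>\<^sup>+x\<in>Z. d x \<partial>P)" if "Z \<in> sets P" for Z
    using that dens emeasure_density[OF dm that] by simp
  have fin: "AE x in P. d x < \<infinity>"
  proof -
    have "AE x in P. RN_deriv P Q x \<noteq> \<infinity>"
      using Q.sigma_finite_measure_axioms ac sQ by (rule P.RN_deriv_finite)
    then show ?thesis by (simp add: d_def less_top)
  qed
  have pos: "AE x in P. 0 < d x"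
  proof -
    define Z where "Z = {x \<in> space P. d x = 0}"
    have Z: "Z \<in> sets P" using dm unfolding Z_def by measurable
    have "emeasure Q Z = (\<integral>\<^sup>+x. 0 \<partial>P)"
      unfolding emd[OF Z] by (rule nn_integral_cong) (auto simp: Z_def indicator_def)
    with emQ[OF Z] have "emeasure M (tau G K ` Z) = 0" by simp
    moreover have "tau G K ` Z \<in> sets M" "tau G K ` Z \<subseteq> B"
      using tau_image_sets[OF adm, of Z] Z setsP tauB by (simp_all add: A_def)
    ultimately have "tau_inv G K ` tau G K ` Z \<in> null_sets M"
      by (intro null') (simp_all add: null_sets_def)
    also have "tau_inv G K ` tau G K ` Z = Z"
    proof -
      have "tau_inv G K (tau G K x) = x" if "x \<in> Z" for x
        using tau_inv_tau[OF K(1)] Z setsP[of Z] that by (auto simp: A_def)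
      then show ?thesis by (simp add: image_image)
    qed
    finally have "Z \<in> null_sets P" using Z emP[OF Z] by (simp add: null_sets_def)
    then have "AE x in P. x \<notin> Z" by (rule AE_not_in)
    then show ?thesis
      using AE_space by eventually_elim (auto simp: Z_def zero_less_iff_neq_zero)
  qed
  show Rm: "RN_ratio G M K \<in> borel_measurable (restrict_space M (src G ` K))"
  proof -
    have "(\<lambda>x. if 0 < d x \<and> d x < \<infinity> then enn2real (d x) else 1) \<in> borel_measurable P"
      using dm by measurable
    then show ?thesis by (simp add: R[abs_def] P_def A_def)
  qed
  show "emeasure M (tau G K ` S) = (\<integral>\<^sup>+x\<in>S. ennreal (RN_ratio G M K x) \<partial>M)"
    if "S \<in> sets M" "S \<subseteq> src G ` K"
  proof -
    have S: "S \<in> sets P" using that setsP[of S] by (simp add: A_def)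
    have "emeasure M (tau G K ` S) = (\<integral>\<^sup>+x\<in>S. d x \<partial>P)" using emQ[OF S] emd[OF S] by simp
    also have "\<dots> = (\<integral>\<^sup>+x\<in>S. ennreal (RN_ratio G M K x) \<partial>P)"
    proof (rule nn_integral_cong_AE)
      show "AE x in P. d x * indicator S x = ennreal (RN_ratio G M K x) * indicator S x"
        using fin pos by eventually_elim (simp add: R)
    qed
    also have "\<dots> = (\<integral>\<^sup>+x. ennreal (RN_ratio G M K x) * indicator S x * indicator A x \<partial>M)"
      using K(2) by (simp add: P_def nn_integral_restrict_space)
    also have "\<dots> = (\<integral>\<^sup>+x\<in>S. ennreal (RN_ratio G M K x) \<partial>M)"
      using that by (intro nn_integral_cong) (auto simp: A_def indicator_def)
    finally show ?thesis .
  qed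
qed

section \<open>Maximal members of families of measurable sets\<close>

text \<open>
  Members are enlarged successively so that the \<open>k\<close>-th one comes within \<open>1/(k+1)\<close> of the measure of
  every member containing it; the union of the sequence then admits no member of larger measure
  above it.
\<close>

lemma (in finite_measure) exists_measure_maximal:
  assumes sets: "F \<subseteq> sets M" and ne: "F \<noteq> {}"
    and UN: "\<And>f :: nat \<Rightarrow> 'a set. incseq f \<Longrightarrow> range f \<subseteq> F \<Longrightarrow> (\<Union>k. f k) \<in> F"
  obtains A where "A \<in> F" "\<And>B. B \<in> F \<Longrightarrow> A \<subseteq> B \<Longrightarrow> measure M B \<le> measure M A"
proof -
  define P where "P k B \<longleftrightarrow> B \<in> F \<and> (\<forall>D\<in>F. B \<subseteq> D \<longrightarrow> measure M D \<le> measure M B + 1 / real (Suc k))"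
    for k :: nat and B
  have step: "\<exists>B. P k B \<and> A \<subseteq> B" if A: "A \<in> F" for A k
  proof -
    define S where "S = measure M ` {B \<in> F. A \<subseteq> B}"
    have S: "S \<noteq> {}" "bdd_above S"
      using A bounded_measure by (auto simp: S_def intro!: bdd_aboveI2)
    then have "Sup S - 1 / real (Suc k) < Sup S" by simp
    from less_cSupD[OF S(1) this] obtain B
      where B: "B \<in> F" "A \<subseteq> B" "Sup S - 1 / real (Suc k) < measure M B"
      unfolding S_def by blast
    have "measure M D \<le> measure M B + 1 / real (Suc k)" if "D \<in> F" "B \<subseteq> D" for D
    proof -
      have "measure M D \<le> Sup S"
        using that B S(2) by (intro cSup_upper) (auto simp: S_def)
      with B(3) show ?thesis by linarith
    qed
    with B show ?thesis by (auto simp: P_def)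
  qed
  have "\<exists>f. \<forall>k. P k (f k) \<and> f k \<subseteq> f (Suc k)"
  proof (rule dependent_nat_choice)
    show "\<exists>B. P 0 B" using ne step by blast
    show "\<exists>B. P (Suc k) B \<and> A \<subseteq> B" if "P k A" for A k
      using that step[of A "Suc k"] unfolding P_def by blast
  qed
  then obtain f where f: "\<And>k. P k (f k)" "\<And>k. f k \<subseteq> f (Suc k)" by blast
  define A where "A = (\<Union>k. f k)"
  have AF: "A \<in> F"
    unfolding A_def using f by (intro UN) (auto simp: P_def intro!: incseq_SucI)
  show thesis
  proof (rule that[OF AF])
    fix B assume B: "B \<in> F" "A \<subseteq> B"
    have "measure M B \<le> measure M A + 1 / real (Suc k)" for k
    proof -
      have "f k \<subseteq> B" using B(2) by (auto simp: A_def)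
      then have "measure M B \<le> measure M (f k) + 1 / real (Suc k)"
        using f(1)[of k] B(1) unfolding P_def by blast
      also have "measure M (f k) \<le> measure M A"
        using AF sets by (intro finite_measure_mono) (auto simp: A_def)
      finally show ?thesis by simp
    qed
    moreover have "(\<lambda>k. measure M A + 1 / real (Suc k)) \<longlonglongrightarrow> measure M A + 0"
      using LIMSEQ_inverse_real_of_nat by (intro tendsto_intros) (simp add: inverse_eq_divide)
    ultimately show "measure M B \<le> measure M A"
      by (intro LIMSEQ_le_const) auto
  qed
qed

section \<open>Finite families of partial maps with densities\<close>

lemma sqrt_ratio_bounds:
  fixes r \<theta> :: real
  assumes "1 \<le> \<theta>" "1 / \<theta> \<le> r" "r \<le> \<theta>"
  shows "1 / \<theta> \<le> sqrt r" "sqrt r \<le> \<theta>" "r \<le> \<theta> * sqrt r" "sqrt r \<le> \<theta> * r"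
proof -
  have r: "0 < r" using assms(1,2) by (smt (verit) divide_pos_pos)
  have th: "\<theta> \<le> \<theta>\<^sup>2" "1 / \<theta> / \<theta> \<le> 1 / \<theta>"
    using assms(1) by (simp_all add: power2_eq_square field_simps)
  show up: "sqrt r \<le> \<theta>" using assms th by (intro real_le_lsqrt) auto
  show lo: "1 / \<theta> \<le> sqrt r"
    using assms th by (intro real_le_rsqrt) (simp add: power2_eq_square)
  have rr: "r = sqrt r * sqrt r" using r by simp
  show "r \<le> \<theta> * sqrt r"
    using mult_right_mono[OF up, of "sqrt r"] r by simp
  have "1 \<le> \<theta> * sqrt r" using lo assms(1) by (simp add: field_simps)
  from mult_right_mono[OF this, of "sqrt r"] show "sqrt r \<le> \<theta> * r"
    using r by (simp add: mult.assoc)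
qed

text \<open>
  What remains of a unital symmetric decomposition once the groupoid is forgotten: \<open>s i\<close> is the
  domain of the partial map \<open>t i\<close>, and \<open>R i\<close> is the factor by which it changes measure.
\<close>

locale partial_transports = prob_space M
  for M :: "'a measure" +
  fixes N :: nat and s :: "nat \<Rightarrow> 'a set" and t :: "nat \<Rightarrow> 'a \<Rightarrow> 'a" and R :: "nat \<Rightarrow> 'a \<Rightarrow> real"
  assumes dom_sets: "i \<in> {1..N} \<Longrightarrow> s i \<in> sets M"
    and image_sets: "i \<in> {1..N} \<Longrightarrow> S \<in> sets M \<Longrightarrow> S \<subseteq> s i \<Longrightarrow> t i ` S \<in> sets M"
    and preimage_sets: "i \<in> {1..N} \<Longrightarrow> B \<in> sets M \<Longrightarrow> {x \<in> s i. t i x \<in> B} \<in> sets M"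
    and R_pos: "0 < R i x"
    and R_measurable: "i \<in> {1..N} \<Longrightarrow> R i \<in> borel_measurable (restrict_space M (s i))"
    and emeasure_image: "i \<in> {1..N} \<Longrightarrow> S \<in> sets M \<Longrightarrow> S \<subseteq> s i \<Longrightarrow>
      emeasure M (t i ` S) = (\<integral>\<^sup>+x\<in>S. ennreal (R i x) \<partial>M)"
    and inverse_index: "i \<in> {1..N} \<Longrightarrow> \<exists>j\<in>{1..N}. \<forall>x\<in>s i. t i x \<in> s j \<and> t j (t i x) = x"
    and unit_index: "\<exists>i\<in>{1..N}. s i = space M \<and> (\<forall>x\<in>space M. t i x = x)"
begin

definition reach :: "'a set \<Rightarrow> 'a set" where
  "reach A = (\<Union>i\<in>{1..N}. t i ` (A \<inter> s i))"

definition boundary :: "'a set \<Rightarrow> 'a set \<Rightarrow> 'a set" where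
  "boundary Y A = (reach A - A) \<inter> Y"

text \<open>
  The points of \<open>A\<close> that the \<open>i\<close>-th map carries out of \<open>A\<close> within \<open>Y\<close>. The boundary is
  the union of the images of these sets, and the flow of the Markov kernel is a sum of integrals
  over them, which is why the two can be compared.
\<close>

definition crossing :: "'a set \<Rightarrow> 'a set \<Rightarrow> nat \<Rightarrow> 'a set" where
  "crossing Y A i = {x \<in> A \<inter> s i. t i x \<in> Y - A}"

definition ratio_bound :: "'a set \<Rightarrow> real \<Rightarrow> bool" where
  "ratio_bound Y \<theta> \<longleftrightarrow> (AE x in M. \<forall>i\<in>{1..N}. x \<in> Y \<and> x \<in> s i \<and> t i x \<in> Y \<longrightarrow>
     1 / \<theta> \<le> R i x \<and> R i x \<le> \<theta>)"

definition expands :: "'a set \<Rightarrow> real \<Rightarrow> bool" where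
  "expands Y C \<longleftrightarrow> (\<forall>A\<in>sets M. A \<subseteq> Y \<and> 0 < measure M A \<and> measure M A \<le> 1/2 * measure M Y \<longrightarrow>
     measure M (boundary Y A) > C * measure M A)"

lemma N_pos: "1 \<le> N" using unit_index by auto

lemma ratio_bound_subset: "ratio_bound Y \<theta> \<Longrightarrow> Z \<subseteq> Y \<Longrightarrow> ratio_bound Z \<theta>"
  unfolding ratio_bound_def by (erule AE_mp) (rule AE_I2, blast)

lemma reach_sets [measurable, intro]: "A \<in> sets M \<Longrightarrow> reach A \<in> sets M"
  unfolding reach_def by (intro sets.finite_UN image_sets sets.Int dom_sets) auto

lemma boundary_sets [measurable, intro]: "A \<in> sets M \<Longrightarrow> Y \<in> sets M \<Longrightarrow> boundary Y A \<in> sets M"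
  unfolding boundary_def by auto

lemma crossing_sets [intro]:
  assumes "i \<in> {1..N}" "A \<in> sets M" "Y \<in> sets M"
  shows "crossing Y A i \<in> sets M"
proof -
  have "crossing Y A i = A \<inter> {x \<in> s i. t i x \<in> Y - A}" by (auto simp: crossing_def)
  then show ?thesis using preimage_sets[OF assms(1), of "Y - A"] assms by auto
qed

lemma crossing_subset: "crossing Y A i \<subseteq> s i" by (auto simp: crossing_def)

lemma boundary_eq_crossing: "boundary Y A = (\<Union>i\<in>{1..N}. t i ` crossing Y A i)"
  by (auto simp: boundary_def reach_def crossing_def)

lemma reach_Un: "reach (A \<union> B) = reach A \<union> reach B"
  by (auto simp: reach_def)

lemma reach_mono: "A \<subseteq> B \<Longrightarrow> reach A \<subseteq> reach B"
  by (auto simp: reach_def)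

lemma reach_UN: "reach (\<Union>k. A k) = (\<Union>k. reach (A k))"
  by (auto simp: reach_def)

lemma crossing_ratio:
  assumes "ratio_bound Y \<theta>" "A \<subseteq> Y" "i \<in> {1..N}"
  shows "AE x in M. x \<in> crossing Y A i \<longrightarrow> 1 / \<theta> \<le> R i x \<and> R i x \<le> \<theta>"
  using assms(1) unfolding ratio_bound_def
  by eventually_elim (use assms(2,3) in \<open>auto simp: crossing_def\<close>)

lemma measure_image_crossing:
  assumes "ratio_bound Y \<theta>" "0 \<le> \<theta>" "A \<subseteq> Y" "i \<in> {1..N}" "A \<in> sets M" "Y \<in> sets M"
  shows "measure M (t i ` crossing Y A i) \<le> \<theta> * measure M (crossing Y A i)"
proof -
  note cs = crossing_sets[OF assms(4-6)]
  have "emeasure M (t i ` crossing Y A i) = (\<integral>\<^sup>+x\<in>crossing Y A i. ennreal (R i x) \<partial>M)"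
    by (rule emeasure_image[OF assms(4) cs crossing_subset])
  also have "\<dots> \<le> (\<integral>\<^sup>+x. ennreal \<theta> * indicator (crossing Y A i) x \<partial>M)"
  proof (rule nn_integral_mono_AE)
    show "AE x in M. ennreal (R i x) * indicator (crossing Y A i) x
        \<le> ennreal \<theta> * indicator (crossing Y A i) x"
      using crossing_ratio[OF assms(1,3,4)]
      by eventually_elim (auto simp: indicator_def intro!: ennreal_leI)
  qed
  also have "\<dots> = ennreal (\<theta> * measure M (crossing Y A i))"
    using cs assms(2) by (simp add: nn_integral_cmult_indicator emeasure_eq_measure ennreal_mult)
  finally show ?thesis
    using assms(2) by (simp add: emeasure_eq_measure)
qed

lemma measure_boundary_le:
  assumes "A \<in> sets M" "Y \<in> sets M" and "\<And>i. i \<in> {1..N} \<Longrightarrow> measure M (t i ` crossing Y A i) \<le> b"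
  shows "measure M (boundary Y A) \<le> real N * b"
proof -
  have "measure M (boundary Y A) \<le> (\<Sum>i\<in>{1..N}. measure M (t i ` crossing Y A i))"
    unfolding boundary_eq_crossing
    by (intro measure_UNION_le image_sets crossing_sets crossing_subset assms) auto
  also have "\<dots> \<le> (\<Sum>i\<in>{1..N}. b)" by (rule sum_mono) (rule assms(3))
  finally show ?thesis by simp
qed

text \<open>
  A crossing from \<open>Y - A\<close> into \<open>A\<close> starts at a point of the boundary of \<open>A\<close>, since the inverse map
  crosses from \<open>A\<close> to that point; its image is at most \<open>\<theta>\<close> times as large as the set of
  starting points.
\<close>

lemma boundary_complement_le:
  assumes "ratio_bound Y \<theta>" "0 \<le> \<theta>" "A \<subseteq> Y" "A \<in> sets M" "Y \<in> sets M"
  shows "measure M (boundary Y (Y - A)) \<le> real N * \<theta> * measure M (boundary Y A)"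
proof -
  have "measure M (boundary Y (Y - A)) \<le> real N * (\<theta> * measure M (boundary Y A))"
  proof (rule measure_boundary_le)
    fix i assume i: "i \<in> {1..N}"
    obtain j where j: "j \<in> {1..N}" "\<And>x. x \<in> s i \<Longrightarrow> t i x \<in> s j \<and> t j (t i x) = x"
      using inverse_index[OF i] by blast
    have "x \<in> boundary Y A" if "x \<in> crossing Y (Y - A) i" for x
    proof -
      from that have x: "x \<in> Y - A" "x \<in> s i" "t i x \<in> A"
        by (auto simp: crossing_def)
      with j(2)[of x] have "t i x \<in> crossing Y A j" "t j (t i x) = x"
        by (auto simp: crossing_def)
      then show ?thesis unfolding boundary_eq_crossing using j(1) by force
    qed
    then have "measure M (crossing Y (Y - A) i) \<le> measure M (boundary Y A)"
      using assms by (intro finite_measure_mono) auto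
    moreover have "measure M (t i ` crossing Y (Y - A) i) \<le> \<theta> * measure M (crossing Y (Y - A) i)"
      using assms i by (intro measure_image_crossing) auto
    ultimately show "measure M (t i ` crossing Y (Y - A) i) \<le> \<theta> * measure M (boundary Y A)"
      using assms(2) by (meson mult_left_mono order_trans)
  qed (use assms in auto)
  then show ?thesis by (simp add: mult.assoc)
qed


section \<open>Expansion at intermediate scales\<close>

text \<open>
  Since \<open>Y\<close> misses less than \<open>\<alpha>/2\<close>, the trace of \<open>A\<close> on \<open>Y\<close> has at least half the measure of \<open>A\<close>.
  When it fills more than half of \<open>Y\<close>, its complement in \<open>Y\<close> still has measure at least \<open>1/4\<close>,
  which is enough because \<open>A\<close> itself has measure at most \<open>1/2\<close>.
\<close>

lemma expands_imp_reach_gt: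
  assumes "ratio_bound Y \<theta>" "1 \<le> \<theta>" "Y \<in> sets M" "expands Y C" "0 < C"
    and "\<alpha> \<le> 1/2" "1 - \<alpha> / 2 < measure M Y"
    and A: "A \<in> sets M" "\<alpha> \<le> measure M A" "measure M A \<le> 1/2"
  shows "measure M (reach A - A) > C / (2 * real N * \<theta>) * measure M A"
proof -
  define B where "B = A \<inter> Y"
  have B: "B \<in> sets M" "B \<subseteq> Y" using A(1) assms(3) by (auto simp: B_def)
  have Nt: "1 \<le> real N * \<theta>" using mult_mono[of 1 "real N" 1 \<theta>] N_pos assms(2) by simp
  have "measure M A \<le> measure M (B \<union> (space M - Y))"
    using sets.sets_into_space[OF A(1)] assms(3) B by (intro finite_measure_mono) (auto simp: B_def)
  also have "\<dots> \<le> measure M B + measure M (space M - Y)"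
    using B assms(3) by (intro measure_Un_le) auto
  also have "measure M (space M - Y) = 1 - measure M Y" by (rule prob_compl[OF assms(3)])
  finally have muB: "measure M A / 2 < measure M B" "0 < measure M B"
    using assms(7) A(2,3) measure_nonneg[of M A] by linarith+
  have "measure M B \<le> measure M A" using A(1) by (intro finite_measure_mono) (auto simp: B_def)
  have "C * measure M A / 2 < real N * \<theta> * measure M (boundary Y B)"
  proof (cases "measure M B \<le> 1/2 * measure M Y")
    case True
    have "C * measure M B < measure M (boundary Y B)"
      using assms(4) B True muB unfolding expands_def by blast
    moreover have "C * measure M A / 2 \<le> C * measure M B"
      using muB assms(5) by simp
    moreover have "1 * measure M (boundary Y B) \<le> (real N * \<theta>) * measure M (boundary Y B)"
      by (rule mult_right_mono[OF Nt]) simp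
    ultimately show ?thesis by linarith
  next
    case False
    have D: "measure M (Y - B) = measure M Y - measure M B"
      using B assms(3) by (intro finite_measure_Diff) auto
    then have D': "measure M A / 2 \<le> measure M (Y - B)" "0 < measure M (Y - B)"
      using \<open>measure M B \<le> measure M A\<close> A(2,3) assms(6,7) by linarith+
    have "C * measure M (Y - B) < measure M (boundary Y (Y - B))"
      using assms(4) B assms(3) False D D' unfolding expands_def by (auto simp: field_simps)
    also have "\<dots> \<le> real N * \<theta> * measure M (boundary Y B)"
      using assms(1,2,3) B by (intro boundary_complement_le) auto
    finally have "C * measure M (Y - B) < real N * \<theta> * measure M (boundary Y B)" .
    moreover have "C * (measure M A / 2) \<le> C * measure M (Y - B)"
      using D'(1) assms(5) by (intro mult_left_mono) auto
    ultimately show ?thesis by simp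
  qed
  also have "measure M (boundary Y B) \<le> measure M (reach A - A)"
  proof (rule finite_measure_mono)
    show "boundary Y B \<subseteq> reach A - A" by (auto simp: boundary_def reach_def B_def)
  qed (use A(1) in auto)
  finally have "C * measure M A / 2 < real N * \<theta> * measure M (reach A - A)"
    using Nt by (simp add: mult_left_mono)
  moreover have "0 < real N * \<theta>" using Nt by linarith
  ultimately show ?thesis by (simp add: field_simps)
qed

text \<open>
  \<open>Y\<close> is what remains of \<open>X\<close> after a maximal badly expanding set is removed. The constant \<open>c / (4 N \<theta>)\<close>
  refutes the case in which the enlarged bad set has measure above \<open>1/2\<close>: its complement in \<open>X\<close> has
  measure at least \<open>1/4\<close>, hence boundary larger than \<open>c/4\<close>, while the boundary of the complement is
  at most \<open>N \<theta>\<close> times that of the bad set.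
\<close>

lemma exists_expanding_subset:
  assumes "ratio_bound X \<theta>" "1 \<le> \<theta>" "X \<in> sets M" "0 < c" "0 < \<alpha>" "\<alpha> \<le> 1/4"
    and large: "1/2 + \<alpha> \<le> measure M X"
    and mid: "\<And>A. A \<in> sets M \<Longrightarrow> A \<subseteq> X \<Longrightarrow> \<alpha> \<le> measure M A \<Longrightarrow> measure M A \<le> 1/2 \<Longrightarrow>
      c * measure M A < measure M (boundary X A)"
  obtains Y where "Y \<in> sets M" "Y \<subseteq> X" "measure M X - \<alpha> \<le> measure M Y"
    "expands Y (c / (4 * real N * \<theta>))"
proof -
  define d where "d = c / (4 * real N * \<theta>)"
  have Nt: "1 \<le> real N * \<theta>" using mult_mono[of 1 "real N" 1 \<theta>] N_pos assms(2) by simp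
  then have dN: "real N * \<theta> * d = c / 4" using assms(2) N_pos by (simp add: d_def field_simps)
  have d0: "0 < d" using Nt assms(4) by (auto simp: d_def mult.assoc intro!: divide_pos_pos)
  have dc: "d \<le> c" using mult_right_mono[OF Nt, of d] d0 dN assms(4) by simp
  define F where "F = {A \<in> sets M. A \<subseteq> X \<and> measure M A \<le> 1/2 \<and> measure M (boundary X A) \<le> d * measure M A}"
  have small: "measure M A < \<alpha>" if "A \<in> F" for A
  proof (rule ccontr)
    assume "\<not> measure M A < \<alpha>"
    then have "c * measure M A < measure M (boundary X A)"
      using that by (intro mid) (auto simp: F_def)
    moreover have "measure M (boundary X A) \<le> d * measure M A" using that by (simp add: F_def)
    moreover have "d * measure M A \<le> c * measure M A" using dc by (rule mult_right_mono) simp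
    ultimately show False by linarith
  qed
  \<comment> \<open>Part of the boundary of \<open>f k\<close> may be swallowed by later sets, so \<open>h\<close> keeps only the points
    outside the whole union; in this way it increases to the boundary of the union.\<close>
  have UN: "(\<Union>k. f k) \<in> F" if f: "incseq f" "range f \<subseteq> F" for f :: "nat \<Rightarrow> 'a set"
  proof -
    define U where "U = (\<Union>k. f k)"
    have fk: "f k \<in> sets M" "f k \<subseteq> X" "measure M (f k) \<le> 1/2"
        "measure M (boundary X (f k)) \<le> d * measure M (f k)" for k
      using f(2) by (auto simp: F_def)
    have U: "U \<in> sets M" "U \<subseteq> X" using fk by (auto simp: U_def)
    have lim: "(\<lambda>k. measure M (f k)) \<longlonglongrightarrow> measure M U"
      unfolding U_def using fk f(1) by (intro finite_Lim_measure_incseq) auto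
    have fU: "measure M (f k) \<le> measure M U" for k
      using U by (intro finite_measure_mono) (auto simp: U_def)
    have "measure M U \<le> 1/2" using lim fk(3) by (intro LIMSEQ_le_const2[OF lim]) auto
    moreover have "measure M (boundary X U) \<le> d * measure M U"
    proof -
      define h where "h k = (reach (f k) - U) \<inter> X" for k
      have h: "h k \<in> sets M" for k using fk U assms(3) by (auto simp: h_def)
      have "incseq h"
        using reach_mono[OF incseqD[OF f(1)]] by (fastforce simp: incseq_def h_def)
      moreover have "(\<Union>k. h k) = boundary X U" by (auto simp: h_def boundary_def U_def reach_UN)
      ultimately have lim': "(\<lambda>k. measure M (h k)) \<longlonglongrightarrow> measure M (boundary X U)"
        using finite_Lim_measure_incseq[of h] h by auto
      have "measure M (h k) \<le> d * measure M U" for k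
      proof -
        have "measure M (h k) \<le> measure M (boundary X (f k))"
          using fk assms(3) by (intro finite_measure_mono) (auto simp: h_def boundary_def U_def)
        also have "\<dots> \<le> d * measure M U"
          using fk(4) mult_left_mono[OF fU, of d] d0 by (meson less_imp_le order_trans)
        finally show ?thesis .
      qed
      then show ?thesis by (intro LIMSEQ_le_const2[OF lim']) auto
    qed
    ultimately show ?thesis using U by (simp add: F_def U_def)
  qed
  have "{} \<in> F" by (simp add: F_def boundary_def reach_def)
  then have "F \<noteq> {}" by blast
  moreover have "F \<subseteq> sets M" by (auto simp: F_def)
  ultimately obtain A
    where A: "A \<in> F" and max: "\<And>B. B \<in> F \<Longrightarrow> A \<subseteq> B \<Longrightarrow> measure M B \<le> measure M A"
    using exists_measure_maximal[of F] UN by metis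
  have A': "A \<in> sets M" "A \<subseteq> X" "measure M (boundary X A) \<le> d * measure M A"
    using A by (auto simp: F_def)
  define Y where "Y = X - A"
  have Y: "Y \<in> sets M" "Y \<subseteq> X" using A' assms(3) by (auto simp: Y_def)
  have muY: "measure M Y = measure M X - measure M A"
    unfolding Y_def using A' assms(3) by (intro finite_measure_Diff) auto
  have "expands Y d"
    unfolding expands_def
  proof (intro ballI impI, rule ccontr)
    fix B assume B: "B \<in> sets M" "B \<subseteq> Y \<and> 0 < measure M B \<and> measure M B \<le> 1/2 * measure M Y"
      and "\<not> d * measure M B < measure M (boundary Y B)"
    then have bdB: "measure M (boundary Y B) \<le> d * measure M B" by simp
    \<comment> \<open>The boundary of \<open>A \<union> B\<close> is covered by the boundary of \<open>A\<close> in \<open>X\<close> and that of \<open>B\<close> in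
      \<open>Y\<close>, because points of \<open>A\<close> do not count; so \<open>A \<union> B\<close> expands as badly as \<open>A\<close> and \<open>B\<close>.\<close>
    define E where "E = A \<union> B"
    have E: "E \<in> sets M" "E \<subseteq> X" using A' B Y by (auto simp: E_def)
    have muE: "measure M E = measure M A + measure M B"
      unfolding E_def using A' B by (intro finite_measure_Union) (auto simp: Y_def)
    have "measure M (boundary X E) \<le> measure M (boundary X A \<union> boundary Y B)"
      using A' B Y assms(3) by (intro finite_measure_mono) (auto simp: boundary_def E_def reach_Un Y_def)
    also have "\<dots> \<le> measure M (boundary X A) + measure M (boundary Y B)"
      using A' B Y assms(3) by (intro measure_Un_le) auto
    finally have bdE: "measure M (boundary X E) \<le> d * measure M E"
      using bdB A'(3) by (simp add: muE distrib_left)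
    show False
    proof (cases "measure M E \<le> 1/2")
      case True
      then have "measure M E \<le> measure M A" using E bdE by (intro max) (auto simp: F_def E_def)
      then show False using muE B by simp
    next
      case False
      have D: "measure M (X - E) = measure M X - measure M E"
        using E assms(3) by (intro finite_measure_Diff) auto
      have D4: "1/4 \<le> measure M (X - E)"
        using D muE muY B(2) large small[OF A] by linarith
      have "measure M (X - E) \<le> 1/2" using D False prob_le_1[of X] by linarith
      then have "c * measure M (X - E) < measure M (boundary X (X - E))"
        using D4 assms(3,6) E by (intro mid) auto
      also have "\<dots> \<le> real N * \<theta> * measure M (boundary X E)"
        using assms(1,2,3) E by (intro boundary_complement_le) auto
      also have "\<dots> \<le> real N * \<theta> * (d * 1)"
      proof (intro mult_left_mono)
        show "measure M (boundary X E) \<le> d * 1"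
          using bdE mult_left_mono[OF prob_le_1[of E], of d] d0 by linarith
      qed (use Nt in linarith)
      also have "\<dots> = c * (1/4)" using dN by simp
      also have "\<dots> \<le> c * measure M (X - E)" using D4 assms(4) by simp
      finally show False by simp
    qed
  qed
  moreover have "measure M X - \<alpha> \<le> measure M Y" using muY small[OF A] by linarith
  ultimately show thesis using that Y by (simp add: d_def)
qed

section \<open>Bounded ratio off a small set\<close>

text \<open>
  The densities are finite and positive at every point and there are finitely many of them, so the
  sets on which all of them lie between \<open>1/(k+1)\<close> and \<open>k+1\<close> exhaust the space.
\<close>

lemma exists_ratio_bound:
  assumes "0 < \<delta>"
  obtains Y \<theta> where "Y \<in> sets M" "1 \<le> \<theta>" "1 - \<delta> < measure M Y" "ratio_bound Y \<theta>"
proof -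
  define b where "b k = real (Suc k)" for k
  define Y where "Y k = space M - (\<Union>i\<in>{1..N}. {x \<in> s i. \<not> (1 / b k \<le> R i x \<and> R i x \<le> b k)})" for k
  have Y: "Y k \<in> sets M" for k
  proof -
    have "{x \<in> s i. \<not> (1 / b k \<le> R i x \<and> R i x \<le> b k)} \<in> sets M" if "i \<in> {1..N}" for i
    proof -
      have "{x \<in> space (restrict_space M (s i)). \<not> (1 / b k \<le> R i x \<and> R i x \<le> b k)}
          \<in> sets (restrict_space M (s i))"
        using R_measurable[OF that] by measurable
      then show ?thesis
        using dom_sets[OF that] sets.sets_into_space[OF dom_sets[OF that]]
        by (simp add: sets_restrict_space_iff space_restrict_space Int_absorb2)
    qed
    then show ?thesis unfolding Y_def by (intro sets.Diff sets.finite_UN) auto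
  qed
  have inc: "incseq Y"
  proof (rule incseq_SucI)
    fix k
    have "1 / b (Suc k) \<le> 1 / b k" by (simp add: b_def field_simps)
    moreover have "b k \<le> b (Suc k)" by (simp add: b_def)
    ultimately have "1 / b (Suc k) \<le> r \<and> r \<le> b (Suc k)" if "1 / b k \<le> r" "r \<le> b k" for r
      using that by linarith
    then show "Y k \<subseteq> Y (Suc k)" unfolding Y_def by blast
  qed
  have "x \<in> (\<Union>k. Y k)" if x: "x \<in> space M" for x
  proof -
    have "\<exists>k. \<forall>i\<in>{1..N}. R i x \<le> b k \<and> 1 / R i x \<le> b k"
    proof -
      define m where "m = (\<Sum>i\<in>{1..N}. R i x + 1 / R i x)"
      obtain k where k: "m \<le> real k" using real_arch_simple by blast
      have "R i x + 1 / R i x \<le> m" if "i \<in> {1..N}" for i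
        unfolding m_def using that
        by (intro member_le_sum) (simp_all add: less_imp_le[OF R_pos])
      moreover have "0 < 1 / R i x" for i using R_pos[of i x] by simp
      ultimately have "R i x \<le> b k \<and> 1 / R i x \<le> b k" if "i \<in> {1..N}" for i
        using k R_pos[of i x] that unfolding b_def by (smt (verit) of_nat_Suc)
      then show ?thesis by blast
    qed
    then obtain k where k: "\<And>i. i \<in> {1..N} \<Longrightarrow> R i x \<le> b k \<and> 1 / R i x \<le> b k" by blast
    have "1 / b k \<le> R i x" if "i \<in> {1..N}" for i
      using k[OF that] R_pos[of i x] by (simp add: b_def field_simps)
    with k x have "x \<in> Y k" by (auto simp: Y_def)
    then show ?thesis by blast
  qed
  moreover have "Y k \<subseteq> space M" for k by (auto simp: Y_def)
  ultimately have "(\<Union>k. Y k) = space M" by blast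
  then have "(\<lambda>k. measure M (Y k)) \<longlonglongrightarrow> 1"
    using finite_Lim_measure_incseq[of Y] inc Y prob_space by auto
  then have "eventually (\<lambda>k. 1 - \<delta> < measure M (Y k)) sequentially"
    using assms by (intro order_tendstoD(1)) auto
  then obtain k where k: "1 - \<delta> < measure M (Y k)" by (auto simp: eventually_sequentially)
  have "ratio_bound (Y k) (b k)"
    unfolding ratio_bound_def by (rule AE_I2) (auto simp: Y_def)
  then show thesis using that[of "Y k" "b k"] Y k by (simp add: b_def)
qed

section \<open>The Markov kernel and its flow\<close>

text \<open>
  The unnormalized kernel: dividing \<open>jump Y x\<close> by \<open>weight Y x\<close> gives the transition
  probabilities from \<open>x\<close>.
\<close>

definition jump :: "'a set \<Rightarrow> 'a \<Rightarrow> 'a set \<Rightarrow> real" where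
  "jump Y x B = (\<Sum>i\<in>{i\<in>{1..N}. x \<in> s i \<and> t i x \<in> Y}. sqrt (R i x) * indicator B (t i x))"

definition weight :: "'a set \<Rightarrow> 'a \<Rightarrow> real" where
  "weight Y x = (\<Sum>i\<in>{i\<in>{1..N}. x \<in> s i \<and> t i x \<in> Y}. sqrt (R i x))"

definition weighted_measure :: "'a set \<Rightarrow> 'a measure" where
  "weighted_measure Y = density (restrict_space M Y) (\<lambda>x. ennreal (weight Y x))"

text \<open>The total rate of jumps from \<open>A\<close> to \<open>Y - A\<close>, the numerator in the Cheeger constant.\<close>

definition flow :: "'a set \<Rightarrow> 'a set \<Rightarrow> ennreal" where
  "flow Y A = (\<Sum>i\<in>{1..N}. \<integral>\<^sup>+x\<in>crossing Y A i. ennreal (sqrt (R i x)) \<partial>M)"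

text \<open>
  \<open>R i\<close> is measurable only on \<open>s i\<close>, so measurability on the whole space needs the indicator of a
  subset of \<open>s i\<close>.
\<close>

lemma sqrt_R_measurable:
  assumes "i \<in> {1..N}" "S \<in> sets M" "S \<subseteq> s i"
  shows "(\<lambda>x. sqrt (R i x) * indicator S x) \<in> borel_measurable M"
proof -
  have [measurable]: "(\<lambda>x. indicator (s i) x *\<^sub>R R i x) \<in> borel_measurable M"
    using R_measurable[OF assms(1)] dom_sets[OF assms(1)]
    by (subst (asm) borel_measurable_restrict_space_iff) auto
  note assms(2)[measurable]
  have "(\<lambda>x. sqrt (indicator (s i) x *\<^sub>R R i x) * indicator S x) \<in> borel_measurable M"
    by measurable
  also have "(\<lambda>x. sqrt (indicator (s i) x *\<^sub>R R i x) * indicator S x)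
      = (\<lambda>x. sqrt (R i x) * indicator S x)"
    using assms(3) by (auto simp: indicator_def fun_eq_iff)
  finally show ?thesis .
qed

lemma jump_eq:
  "jump Y x B = (\<Sum>i\<in>{1..N}. sqrt (R i x) * indicator {x \<in> s i. t i x \<in> Y \<inter> B} x)"
proof -
  have "jump Y x B = (\<Sum>i\<in>{1..N}. if x \<in> s i \<and> t i x \<in> Y then sqrt (R i x) * indicator B (t i x) else 0)"
    unfolding jump_def by (rule sum.inter_filter) simp
  also have "\<dots> = (\<Sum>i\<in>{1..N}. sqrt (R i x) * indicator {x \<in> s i. t i x \<in> Y \<inter> B} x)"
    by (rule sum.cong) (auto simp: indicator_def)
  finally show ?thesis .
qed

lemma weight_eq_jump: "weight Y x = jump Y x Y"
  unfolding weight_def jump_def by (rule sum.cong) auto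

lemma jump_measurable [measurable]:
  assumes "Y \<in> sets M" "B \<in> sets M"
  shows "(\<lambda>x. jump Y x B) \<in> borel_measurable M"
  unfolding jump_eq using assms
  by (intro borel_measurable_sum sqrt_R_measurable preimage_sets) auto

lemma weight_measurable [measurable]: "Y \<in> sets M \<Longrightarrow> weight Y \<in> borel_measurable M"
  using jump_measurable[of Y Y] by (simp add: weight_eq_jump[abs_def])

lemma jump_nonneg: "0 \<le> jump Y x B"
  unfolding jump_def by (intro sum_nonneg) (simp add: less_imp_le[OF R_pos])

lemma unit_summand:
  assumes "x \<in> Y" "x \<in> space M"
  obtains i where "i \<in> {i\<in>{1..N}. x \<in> s i \<and> t i x \<in> Y}"
proof -
  from unit_index obtain i where "i \<in> {1..N}" "s i = space M" "\<forall>x\<in>space M. t i x = x" by blast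
  with assms that[of i] show thesis by simp
qed

lemma weight_pos:
  assumes "x \<in> Y" "x \<in> space M"
  shows "0 < weight Y x"
proof -
  obtain i where "i \<in> {i\<in>{1..N}. x \<in> s i \<and> t i x \<in> Y}" using unit_summand[OF assms] .
  then show ?thesis unfolding weight_def using R_pos by (intro sum_pos) auto
qed

text \<open>
  The lower bound comes from the identity map alone: every \<open>x \<in> Y\<close> is mapped into \<open>Y\<close> by it.
\<close>

lemma weight_bounds:
  assumes "ratio_bound Y \<theta>" "1 \<le> \<theta>"
  shows "AE x in M. x \<in> Y \<longrightarrow> 1 / \<theta> \<le> weight Y x \<and> weight Y x \<le> real N * \<theta>"
  using assms(1) AE_space unfolding ratio_bound_def
proof eventually_elim
  case (elim x)
  show ?case
  proof
    assume x: "x \<in> Y"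
    let ?I = "{i\<in>{1..N}. x \<in> s i \<and> t i x \<in> Y}"
    have sq: "1 / \<theta> \<le> sqrt (R i x)" "sqrt (R i x) \<le> \<theta>" if "i \<in> ?I" for i
      using elim(1) x that sqrt_ratio_bounds(1,2)[OF assms(2), of "R i x"] by auto
    obtain i where i: "i \<in> ?I" using unit_summand[OF x elim(2)] .
    have "1 / \<theta> \<le> sqrt (R i x)" using sq(1)[OF i] .
    also have "\<dots> \<le> weight Y x"
      unfolding weight_def using i R_pos by (intro member_le_sum) (auto intro: less_imp_le)
    finally have "1 / \<theta> \<le> weight Y x" .
    moreover have "weight Y x \<le> real N * \<theta>"
    proof -
      have "weight Y x \<le> real (card ?I) * \<theta>"
        unfolding weight_def using sq(2) by (rule sum_bounded_above)
      also have "card ?I \<le> card {1..N}" by (rule card_mono) auto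
      then have "real (card ?I) * \<theta> \<le> real N * \<theta>" using assms(2) by (intro mult_right_mono) auto
      finally show ?thesis .
    qed
    ultimately show "1 / \<theta> \<le> weight Y x \<and> weight Y x \<le> real N * \<theta>" ..
  qed
qed

lemma space_weighted_measure: "Y \<in> sets M \<Longrightarrow> space (weighted_measure Y) = Y"
  using sets.sets_into_space[of Y M] by (simp add: weighted_measure_def space_restrict_space Int_absorb2)

lemma sets_weighted_measure_iff: "Y \<in> sets M \<Longrightarrow> A \<in> sets (weighted_measure Y) \<longleftrightarrow> A \<in> sets M \<and> A \<subseteq> Y"
  by (auto simp: weighted_measure_def sets_restrict_space_iff)

lemma nn_integral_weighted_measure:
  assumes Y: "Y \<in> sets M" and f: "f \<in> borel_measurable M"
  shows "(\<integral>\<^sup>+x. f x \<partial>weighted_measure Y) = (\<integral>\<^sup>+x\<in>Y. ennreal (weight Y x) * f x \<partial>M)"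
proof -
  have "weight Y \<in> borel_measurable M" "Y \<inter> space M \<in> sets M" using Y by auto
  then show ?thesis
    unfolding weighted_measure_def using f
    by (simp add: nn_integral_density measurable_restrict_space1 nn_integral_restrict_space)
qed

lemma emeasure_weighted_measure:
  assumes "Y \<in> sets M" "A \<in> sets M" "A \<subseteq> Y"
  shows "emeasure (weighted_measure Y) A = (\<integral>\<^sup>+x\<in>A. ennreal (weight Y x) \<partial>M)"
proof -
  have "emeasure (weighted_measure Y) A = (\<integral>\<^sup>+x. indicator A x \<partial>weighted_measure Y)"
    using assms by (simp add: sets_weighted_measure_iff)
  also have "\<dots> = (\<integral>\<^sup>+x\<in>A. ennreal (weight Y x) \<partial>M)"
    using assms
    by (subst nn_integral_weighted_measure) (auto intro!: nn_integral_cong simp: indicator_def)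
  finally show ?thesis .
qed

lemma emeasure_weighted_measure_bounds:
  assumes "ratio_bound Y \<theta>" "1 \<le> \<theta>" "Y \<in> sets M" "A \<in> sets M" "A \<subseteq> Y"
  shows "ennreal (measure M A / \<theta>) \<le> emeasure (weighted_measure Y) A"
    and "emeasure (weighted_measure Y) A \<le> ennreal (real N * \<theta> * measure M A)"
proof -
  have "ennreal (measure M A / \<theta>) = ennreal (1 / \<theta>) * emeasure M A"
    using assms(2) by (simp add: emeasure_eq_measure ennreal_mult[symmetric])
  also have "\<dots> = (\<integral>\<^sup>+x. ennreal (1 / \<theta>) * indicator A x \<partial>M)"
    using assms(4) by (simp add: nn_integral_cmult_indicator)
  also have "\<dots> \<le> emeasure (weighted_measure Y) A"
    unfolding emeasure_weighted_measure[OF assms(3-5)]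
  proof (rule nn_integral_mono_AE)
    show "AE x in M. ennreal (1 / \<theta>) * indicator A x \<le> ennreal (weight Y x) * indicator A x"
      using weight_bounds[OF assms(1,2)]
      by eventually_elim (use assms(5) in \<open>auto simp: indicator_def intro!: ennreal_leI\<close>)
  qed
  finally show "ennreal (measure M A / \<theta>) \<le> emeasure (weighted_measure Y) A" .
  have "emeasure (weighted_measure Y) A \<le> (\<integral>\<^sup>+x. ennreal (real N * \<theta>) * indicator A x \<partial>M)"
    unfolding emeasure_weighted_measure[OF assms(3-5)]
  proof (rule nn_integral_mono_AE)
    show "AE x in M. ennreal (weight Y x) * indicator A x \<le> ennreal (real N * \<theta>) * indicator A x"
      using weight_bounds[OF assms(1,2)]
      by eventually_elim (use assms(5) in \<open>auto simp: indicator_def intro!: ennreal_leI\<close>)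
  qed
  also have "\<dots> = ennreal (real N * \<theta> * measure M A)"
    using assms(2,4) by (simp add: nn_integral_cmult_indicator emeasure_eq_measure ennreal_mult)
  finally show "emeasure (weighted_measure Y) A \<le> ennreal (real N * \<theta> * measure M A)" .
qed

lemma finite_measure_weighted_measure:
  assumes "ratio_bound Y \<theta>" "1 \<le> \<theta>" "Y \<in> sets M"
  shows "finite_measure (weighted_measure Y)"
proof
  have "emeasure (weighted_measure Y) Y < \<infinity>"
    using emeasure_weighted_measure_bounds(2)[OF assms assms(3) order_refl]
    by (rule le_less_trans) simp
  then show "emeasure (weighted_measure Y) (space (weighted_measure Y)) \<noteq> \<infinity>"
    using assms(3) by (simp add: space_weighted_measure)
qed

lemma weighted_measure_bounds:
  assumes "ratio_bound Y \<theta>" "1 \<le> \<theta>" "Y \<in> sets M" "A \<in> sets M" "A \<subseteq> Y"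
  shows "measure M A \<le> \<theta> * measure (weighted_measure Y) A"
    and "measure (weighted_measure Y) A \<le> real N * \<theta> * measure M A"
proof -
  interpret W: finite_measure "weighted_measure Y" by (rule finite_measure_weighted_measure[OF assms(1-3)])
  have "measure M A / \<theta> \<le> measure (weighted_measure Y) A"
    using emeasure_weighted_measure_bounds(1)[OF assms] by (simp add: W.emeasure_eq_measure)
  then show "measure M A \<le> \<theta> * measure (weighted_measure Y) A"
    using assms(2) by (simp add: field_simps)
  show "measure (weighted_measure Y) A \<le> real N * \<theta> * measure M A"
    using emeasure_weighted_measure_bounds(2)[OF assms] assms(2) by (simp add: W.emeasure_eq_measure)
qed

text \<open>
  A crossing with density \<open>R\<close> contributes \<open>\<integral> R\<close> to the boundary and \<open>\<integral> \<surd>R\<close> to the flow. Bounded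
  ratio makes these two comparable, in one direction here and in the other in the next lemma.
\<close>

lemma emeasure_boundary_le_flow:
  assumes "ratio_bound Y \<theta>" "1 \<le> \<theta>" "Y \<in> sets M" "A \<in> sets M" "A \<subseteq> Y"
  shows "emeasure M (boundary Y A) \<le> ennreal \<theta> * flow Y A"
proof -
  have "emeasure M (boundary Y A) \<le> (\<Sum>i\<in>{1..N}. emeasure M (t i ` crossing Y A i))"
    unfolding boundary_eq_crossing using assms
    by (intro emeasure_subadditive_finite) (auto intro!: image_sets crossing_subset)
  also have "\<dots> \<le> (\<Sum>i\<in>{1..N}. ennreal \<theta> * (\<integral>\<^sup>+x\<in>crossing Y A i. ennreal (sqrt (R i x)) \<partial>M))"
  proof (rule sum_mono)
    fix i assume i: "i \<in> {1..N}"
    note cs = crossing_sets[OF i assms(4,3)]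
    note [measurable] = sqrt_R_measurable[OF i cs crossing_subset]
    have eq: "ennreal (sqrt (R i x)) * indicator (crossing Y A i) x
        = ennreal (sqrt (R i x) * indicator (crossing Y A i) x)" for x
      by (auto simp: indicator_def)
    have "emeasure M (t i ` crossing Y A i) = (\<integral>\<^sup>+x\<in>crossing Y A i. ennreal (R i x) \<partial>M)"
      by (rule emeasure_image[OF i cs crossing_subset])
    also have "\<dots> \<le> (\<integral>\<^sup>+x. ennreal \<theta> * ennreal (sqrt (R i x) * indicator (crossing Y A i) x) \<partial>M)"
    proof (rule nn_integral_mono_AE)
      show "AE x in M. ennreal (R i x) * indicator (crossing Y A i) x
          \<le> ennreal \<theta> * ennreal (sqrt (R i x) * indicator (crossing Y A i) x)"
        using crossing_ratio[OF assms(1,5) i]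
      proof eventually_elim
        case (elim x)
        then show ?case
          using sqrt_ratio_bounds(3)[OF assms(2), of "R i x"] assms(2) R_pos[of i x]
          by (auto simp: indicator_def ennreal_mult[symmetric] intro!: ennreal_leI)
      qed
    qed
    also have "\<dots> = ennreal \<theta> * (\<integral>\<^sup>+x\<in>crossing Y A i. ennreal (sqrt (R i x)) \<partial>M)"
      unfolding eq by (rule nn_integral_cmult) measurable
    finally show "emeasure M (t i ` crossing Y A i)
        \<le> ennreal \<theta> * (\<integral>\<^sup>+x\<in>crossing Y A i. ennreal (sqrt (R i x)) \<partial>M)" .
  qed
  also have "\<dots> = ennreal \<theta> * flow Y A" by (simp add: flow_def sum_distrib_left)
  finally show ?thesis .
qed

lemma flow_le_emeasure_boundary:
  assumes "ratio_bound Y \<theta>" "1 \<le> \<theta>" "Y \<in> sets M" "A \<in> sets M" "A \<subseteq> Y"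
  shows "flow Y A \<le> ennreal (real N * \<theta> * measure M (boundary Y A))"
proof -
  have "flow Y A \<le> (\<Sum>i\<in>{1..N}. ennreal (\<theta> * measure M (boundary Y A)))"
    unfolding flow_def
  proof (rule sum_mono)
    fix i assume i: "i \<in> {1..N}"
    note cs = crossing_sets[OF i assms(4,3)]
    let ?c = "crossing Y A i"
    have bound: "AE x in M. sqrt (R i x) * indicator ?c x \<le> \<theta> * (R i x * indicator ?c x)"
      using crossing_ratio[OF assms(1,5) i]
    proof eventually_elim
      case (elim x)
      then show ?case
        using sqrt_ratio_bounds(4)[OF assms(2), of "R i x"] by (auto simp: indicator_def)
    qed
    \<comment> \<open>The density is measurable as the square of its square root.\<close>
    have meas: "(\<lambda>x. ennreal (R i x) * indicator ?c x) \<in> borel_measurable M"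
    proof -
      have [measurable]: "(\<lambda>x. (sqrt (R i x) * indicator ?c x)\<^sup>2) \<in> borel_measurable M"
        using sqrt_R_measurable[OF i cs crossing_subset] by measurable
      have "(\<lambda>x. ennreal ((sqrt (R i x) * indicator ?c x)\<^sup>2)) \<in> borel_measurable M" by measurable
      also have "(\<lambda>x. ennreal ((sqrt (R i x) * indicator ?c x)\<^sup>2))
          = (\<lambda>x. ennreal (R i x) * indicator ?c x)"
        using R_pos by (auto simp: indicator_def fun_eq_iff less_imp_le)
      finally show ?thesis .
    qed
    have "(\<integral>\<^sup>+x\<in>?c. ennreal (sqrt (R i x)) \<partial>M)
        \<le> (\<integral>\<^sup>+x. ennreal \<theta> * (ennreal (R i x) * indicator ?c x) \<partial>M)"
    proof (rule nn_integral_mono_AE)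
      show "AE x in M. ennreal (sqrt (R i x)) * indicator ?c x
          \<le> ennreal \<theta> * (ennreal (R i x) * indicator ?c x)"
        using bound
      proof eventually_elim
        case (elim x)
        then show ?case using assms(2) R_pos[of i x]
          by (auto simp: indicator_def ennreal_mult[symmetric] intro!: ennreal_leI)
      qed
    qed
    also have "\<dots> = ennreal \<theta> * emeasure M (t i ` ?c)"
      unfolding emeasure_image[OF i cs crossing_subset] by (rule nn_integral_cmult[OF meas])
    also have "\<dots> \<le> ennreal \<theta> * emeasure M (boundary Y A)"
    proof (intro mult_left_mono emeasure_mono)
      show "t i ` ?c \<subseteq> boundary Y A" unfolding boundary_eq_crossing using i by blast
    qed (use assms in auto)
    also have "\<dots> = ennreal (\<theta> * measure M (boundary Y A))"
      using assms(2) by (simp add: emeasure_eq_measure ennreal_mult)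
    finally show "(\<integral>\<^sup>+x\<in>?c. ennreal (sqrt (R i x)) \<partial>M) \<le> ennreal (\<theta> * measure M (boundary Y A))" .
  qed
  also have "\<dots> = ennreal (real N * \<theta> * measure M (boundary Y A))"
    using assms(2) by (simp add: ennreal_mult ennreal_of_nat_eq_real_of_nat mult.assoc)
  finally show ?thesis .
qed

text \<open>
  The normalization of the kernel cancels against the density of the reversing measure. This is
  legitimate because the weight never vanishes on \<open>Y\<close>.
\<close>

lemma nn_integral_kernel_eq_flow:
  assumes "Y \<in> sets M" "A \<in> sets M" "A \<subseteq> Y"
  shows "(\<integral>\<^sup>+x\<in>A. ennreal (1 / weight Y x * jump Y x (Y - A)) \<partial>weighted_measure Y) = flow Y A"
proof -
  have [measurable]: "(\<lambda>x. jump Y x (Y - A)) \<in> borel_measurable M" "weight Y \<in> borel_measurable M"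
      "A \<in> sets M"
    using assms by auto
  have "(\<integral>\<^sup>+x\<in>A. ennreal (1 / weight Y x * jump Y x (Y - A)) \<partial>weighted_measure Y)
      = (\<integral>\<^sup>+x\<in>Y. ennreal (weight Y x) *
          (ennreal (1 / weight Y x * jump Y x (Y - A)) * indicator A x) \<partial>M)"
    by (rule nn_integral_weighted_measure[OF assms(1)]) measurable
  also have "\<dots> = (\<integral>\<^sup>+x. (\<Sum>i\<in>{1..N}. ennreal (sqrt (R i x) * indicator (crossing Y A i) x)) \<partial>M)"
  proof (rule nn_integral_cong)
    fix x assume x: "x \<in> space M"
    show "ennreal (weight Y x) * (ennreal (1 / weight Y x * jump Y x (Y - A)) * indicator A x) * indicator Y x
        = (\<Sum>i\<in>{1..N}. ennreal (sqrt (R i x) * indicator (crossing Y A i) x))"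
    proof (cases "x \<in> A")
      case True
      then have "0 < weight Y x" using weight_pos x assms(3) by blast
      then have "ennreal (weight Y x) * ennreal (1 / weight Y x * jump Y x (Y - A)) = ennreal (jump Y x (Y - A))"
        using jump_nonneg by (subst ennreal_mult[symmetric]) auto
      also have "\<dots> = ennreal (\<Sum>i\<in>{1..N}. sqrt (R i x) * indicator (crossing Y A i) x)"
        unfolding jump_eq using True
        by (intro arg_cong[where f=ennreal] sum.cong) (auto simp: indicator_def crossing_def)
      also have "\<dots> = (\<Sum>i\<in>{1..N}. ennreal (sqrt (R i x) * indicator (crossing Y A i) x))"
        by (intro sum_ennreal[symmetric]) (simp add: less_imp_le[OF R_pos])
      finally show ?thesis using True assms(3) by auto
    next
      case False
      then show ?thesis by (auto simp: crossing_def)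
    qed
  qed
  also have "\<dots> = (\<Sum>i\<in>{1..N}. \<integral>\<^sup>+x. ennreal (sqrt (R i x) * indicator (crossing Y A i) x) \<partial>M)"
  proof (rule nn_integral_sum)
    fix i assume i: "i \<in> {1..N}"
    note [measurable] = sqrt_R_measurable[OF i crossing_sets[OF i assms(2,1)] crossing_subset]
    show "(\<lambda>x. ennreal (sqrt (R i x) * indicator (crossing Y A i) x)) \<in> borel_measurable M"
      by measurable
  qed
  also have "\<dots> = flow Y A"
    unfolding flow_def by (intro sum.cong nn_integral_cong refl) (auto simp: indicator_def)
  finally show ?thesis .
qed

lemma flow_finite:
  assumes "ratio_bound Y \<theta>" "1 \<le> \<theta>" "Y \<in> sets M" "A \<in> sets M" "A \<subseteq> Y"
  shows "flow Y A = ennreal (enn2real (flow Y A))"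
proof -
  have "flow Y A < \<infinity>" using flow_le_emeasure_boundary[OF assms] by (rule le_less_trans) simp
  then show ?thesis by simp
qed

lemma flow_bounds:
  assumes "ratio_bound Y \<theta>" "1 \<le> \<theta>" "Y \<in> sets M" "A \<in> sets M" "A \<subseteq> Y"
  shows "measure M (boundary Y A) \<le> \<theta> * enn2real (flow Y A)"
    and "enn2real (flow Y A) \<le> real N * \<theta> * measure M (boundary Y A)"
proof -
  have "ennreal (measure M (boundary Y A)) \<le> ennreal (\<theta> * enn2real (flow Y A))"
    using emeasure_boundary_le_flow[OF assms] flow_finite[OF assms] assms(2)
    by (simp add: emeasure_eq_measure ennreal_mult)
  then show "measure M (boundary Y A) \<le> \<theta> * enn2real (flow Y A)"
    using assms(2) by simp
  show "enn2real (flow Y A) \<le> real N * \<theta> * measure M (boundary Y A)"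
    using flow_le_emeasure_boundary[OF assms] assms(2) by (intro enn2real_leI) auto
qed

section \<open>Expansion versus Markov expansion\<close>

text \<open>
  The bound \<open>c \<le>\<close> Cheeger constant, stated in real numbers and free of divisions; see
  \<open>le_cheeger_constant_iff\<close>.
\<close>

definition markov_expands :: "'a set \<Rightarrow> real \<Rightarrow> bool" where
  "markov_expands Y c \<longleftrightarrow> (\<forall>A\<in>sets M. A \<subseteq> Y \<and> 0 < measure (weighted_measure Y) A \<and>
     measure (weighted_measure Y) A \<le> 1/2 * measure (weighted_measure Y) Y \<longrightarrow>
     c * measure (weighted_measure Y) A \<le> enn2real (flow Y A))"

text \<open>
  Comparing measures costs a factor \<open>N \<theta>\<close>, comparing flow and boundary a factor \<open>\<theta>\<close>, and passing to
  the complement, needed when \<open>A\<close> is at most half of \<open>Y\<close> for the reversing measure but more than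
  half for \<open>\<mu>\<close>, another \<open>N \<theta>\<close>.
\<close>

lemma expands_imp_markov_expands:
  assumes rb: "ratio_bound Y \<theta>" "1 \<le> \<theta>" "Y \<in> sets M" and "expands Y C" "0 < C"
  shows "markov_expands Y (C / (real N ^ 2 * \<theta> ^ 3))"
  unfolding markov_expands_def
proof (intro ballI impI)
  fix A
  let ?w = "measure (weighted_measure Y)"
  let ?f = "enn2real (flow Y A)"
  assume A: "A \<in> sets M" "A \<subseteq> Y \<and> 0 < ?w A \<and> ?w A \<le> 1/2 * ?w Y"
  interpret W: finite_measure "weighted_measure Y" by (rule finite_measure_weighted_measure[OF rb])
  have Nt: "1 \<le> real N * \<theta>" using mult_mono[of 1 "real N" 1 \<theta>] N_pos rb(2) by simp
  have sA: "A \<in> sets (weighted_measure Y)" "Y \<in> sets (weighted_measure Y)" using A rb(3) by (auto simp: sets_weighted_measure_iff)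
  have pos: "0 < measure M B" if "B \<in> sets M" "B \<subseteq> Y" "0 < ?w B" for B
    using weighted_measure_bounds(2)[OF rb that(1,2)] that(3) Nt
    by (metis less_le_trans less_le measure_nonneg mult_zero_right not_less)
  have "C * ?w A \<le> (real N * \<theta>) * (real N * \<theta> * (\<theta> * ?f))"
  proof (cases "measure M A \<le> 1/2 * measure M Y")
    case True
    then have "C * measure M A < measure M (boundary Y A)"
      using assms(4) A pos unfolding expands_def by blast
    also have "\<dots> \<le> \<theta> * ?f" using A by (intro flow_bounds rb) auto
    also have "\<dots> \<le> real N * \<theta> * (\<theta> * ?f)" using mult_right_mono[OF Nt, of "\<theta> * ?f"] rb(2) by simp
    finally have le: "C * measure M A \<le> real N * \<theta> * (\<theta> * ?f)" by simp
    have "C * ?w A \<le> C * (real N * \<theta> * measure M A)"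
      using weighted_measure_bounds(2)[OF rb, of A] A assms(5) by simp
    also have "\<dots> = (real N * \<theta>) * (C * measure M A)" by simp
    also have "\<dots> \<le> (real N * \<theta>) * (real N * \<theta> * (\<theta> * ?f))"
      using le Nt by (intro mult_left_mono) linarith+
    finally show ?thesis .
  next
    case False
    define D where "D = Y - A"
    have D: "D \<in> sets M" "D \<subseteq> Y" using A rb(3) by (auto simp: D_def)
    have "?w D = ?w Y - ?w A" unfolding D_def using A sA by (intro W.finite_measure_Diff) auto
    then have wD: "?w A \<le> ?w D" "0 < ?w D" using A by auto
    have "measure M D = measure M Y - measure M A"
      unfolding D_def using A rb(3) by (intro finite_measure_Diff) auto
    then have "measure M D \<le> 1/2 * measure M Y" using False by simp
    then have "C * measure M D < measure M (boundary Y D)"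
      using assms(4) D pos[OF D wD(2)] unfolding expands_def by blast
    also have "\<dots> \<le> real N * \<theta> * measure M (boundary Y A)"
      unfolding D_def using rb A by (intro boundary_complement_le) auto
    also have "\<dots> \<le> real N * \<theta> * (\<theta> * ?f)"
      using A Nt flow_bounds(1)[OF rb, of A] by (intro mult_left_mono) auto
    finally have le: "C * measure M D \<le> real N * \<theta> * (\<theta> * ?f)" by simp
    have "C * ?w A \<le> C * (real N * \<theta> * measure M D)"
      using weighted_measure_bounds(2)[OF rb D] wD(1) assms(5) by simp
    also have "\<dots> = (real N * \<theta>) * (C * measure M D)" by simp
    also have "\<dots> \<le> (real N * \<theta>) * (real N * \<theta> * (\<theta> * ?f))"
      using le Nt by (intro mult_left_mono) linarith+
    finally show ?thesis .
  qed
  also have "\<dots> = (real N ^ 2 * \<theta> ^ 3) * ?f" by (simp add: power2_eq_square power3_eq_cube)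
  finally show "C / (real N ^ 2 * \<theta> ^ 3) * ?w A \<le> ?f"
    using N_pos rb(2) by (simp add: field_simps)
qed

text \<open>
  The same comparison with the roles of the two measures exchanged. The factor \<open>2\<close> makes the
  inequality strict.
\<close>

lemma markov_expands_imp_expands:
  assumes rb: "ratio_bound Y \<theta>" "1 \<le> \<theta>" "Y \<in> sets M" and "markov_expands Y C" "0 < C"
  shows "expands Y (C / (2 * real N ^ 2 * \<theta> ^ 3))"
  unfolding expands_def
proof (intro ballI impI)
  fix A
  let ?w = "measure (weighted_measure Y)"
  let ?b = "measure M (boundary Y A)"
  assume A: "A \<in> sets M" "A \<subseteq> Y \<and> 0 < measure M A \<and> measure M A \<le> 1/2 * measure M Y"
  interpret W: finite_measure "weighted_measure Y" by (rule finite_measure_weighted_measure[OF rb])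
  have Nt: "1 \<le> real N * \<theta>" using mult_mono[of 1 "real N" 1 \<theta>] N_pos rb(2) by simp
  have sA: "A \<in> sets (weighted_measure Y)" "Y \<in> sets (weighted_measure Y)" using A rb(3) by (auto simp: sets_weighted_measure_iff)
  have pos: "0 < ?w B" if "B \<in> sets M" "B \<subseteq> Y" "0 < measure M B" for B
    using weighted_measure_bounds(1)[OF rb that(1,2)] that(3) rb(2)
    by (metis less_le_trans less_le measure_nonneg mult_zero_right not_less)
  have key: "C * measure M A \<le> \<theta> * (C * ?w B)" if "B \<in> sets M" "B \<subseteq> Y" "measure M A \<le> measure M B" for B
  proof -
    have "C * measure M A \<le> C * (\<theta> * ?w B)"
      using weighted_measure_bounds(1)[OF rb that(1,2)] that(3) assms(5) by (intro mult_left_mono) auto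
    then show ?thesis by (simp add: mult.left_commute)
  qed
  have "C * measure M A \<le> \<theta> * (real N * \<theta> * (real N * \<theta> * ?b))"
  proof (cases "?w A \<le> 1/2 * ?w Y")
    case True
    then have "C * ?w A \<le> enn2real (flow Y A)"
      using assms(4) A pos unfolding markov_expands_def by blast
    also have "\<dots> \<le> real N * \<theta> * ?b" using A by (intro flow_bounds rb) auto
    also have "\<dots> \<le> real N * \<theta> * (real N * \<theta> * ?b)"
      using mult_right_mono[OF Nt, of "real N * \<theta> * ?b"] rb(2) by simp
    finally have "\<theta> * (C * ?w A) \<le> \<theta> * (real N * \<theta> * (real N * \<theta> * ?b))"
      using rb(2) by (intro mult_left_mono) auto
    then show ?thesis using key[of A] A by auto
  next
    case False
    define D where "D = Y - A"
    have D: "D \<in> sets M" "D \<subseteq> Y" using A rb(3) by (auto simp: D_def)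
    have "?w D = ?w Y - ?w A" unfolding D_def using A sA by (intro W.finite_measure_Diff) auto
    then have wD: "?w D \<le> 1/2 * ?w Y" using False by simp
    have "measure M D = measure M Y - measure M A"
      unfolding D_def using A rb(3) by (intro finite_measure_Diff) auto
    then have mD: "measure M A \<le> measure M D" "0 < measure M D" using A by auto
    have "C * ?w D \<le> enn2real (flow Y D)"
      using assms(4) D wD pos[OF D mD(2)] unfolding markov_expands_def by blast
    also have "\<dots> \<le> real N * \<theta> * measure M (boundary Y D)" using D by (intro flow_bounds rb) auto
    also have "\<dots> \<le> real N * \<theta> * (real N * \<theta> * ?b)"
      unfolding D_def using rb A Nt by (intro mult_left_mono boundary_complement_le) auto
    finally have "\<theta> * (C * ?w D) \<le> \<theta> * (real N * \<theta> * (real N * \<theta> * ?b))"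
      using rb(2) by (intro mult_left_mono) auto
    then show ?thesis using key[OF D mD(1)] by simp
  qed
  also have "\<dots> = (real N ^ 2 * \<theta> ^ 3) * ?b" by (simp add: power2_eq_square power3_eq_cube)
  finally have le: "C * measure M A \<le> (real N ^ 2 * \<theta> ^ 3) * ?b" .
  have Z: "0 < real N ^ 2 * \<theta> ^ 3" using N_pos rb(2) by simp
  have "0 < C * measure M A" using A assms(5) by simp
  then have "C * measure M A < 2 * ((real N ^ 2 * \<theta> ^ 3) * ?b)" using le by linarith
  then show "C / (2 * real N ^ 2 * \<theta> ^ 3) * measure M A < ?b"
    using Z by (simp add: field_simps)
qed

lemma cheeger_term:
  assumes rb: "ratio_bound Y \<theta>" "1 \<le> \<theta>" "Y \<in> sets M" "A \<in> sets M" "A \<subseteq> Y"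
    and "0 < measure (weighted_measure Y) A"
  shows "1 / emeasure (weighted_measure Y) A *
      (\<integral>\<^sup>+x\<in>A. ennreal (1 / weight Y x * jump Y x (space (weighted_measure Y) - A)) \<partial>weighted_measure Y)
    = ennreal (enn2real (flow Y A) / measure (weighted_measure Y) A)"
proof -
  interpret W: finite_measure "weighted_measure Y" by (rule finite_measure_weighted_measure[OF rb(1-3)])
  have "1 / emeasure (weighted_measure Y) A = ennreal (1 / measure (weighted_measure Y) A)"
    using divide_ennreal[of 1 "measure (weighted_measure Y) A"] assms(6) by (simp add: W.emeasure_eq_measure)
  moreover have "(\<integral>\<^sup>+x\<in>A. ennreal (1 / weight Y x * jump Y x (space (weighted_measure Y) - A)) \<partial>weighted_measure Y)
      = ennreal (enn2real (flow Y A))"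
    using nn_integral_kernel_eq_flow[OF rb(3-5)] flow_finite[OF rb] rb(3) by (simp add: space_weighted_measure)
  ultimately show ?thesis by (simp add: ennreal_mult[symmetric])
qed

lemma le_cheeger_constant_iff:
  assumes rb: "ratio_bound Y \<theta>" "1 \<le> \<theta>" "Y \<in> sets M" and "0 \<le> c"
  shows "ennreal c \<le> cheeger_constant (weighted_measure Y) (\<lambda>x B. ennreal (1 / weight Y x * jump Y x B))
    \<longleftrightarrow> markov_expands Y c"
proof -
  interpret W: finite_measure "weighted_measure Y" by (rule finite_measure_weighted_measure[OF rb])
  have half: "(1/2 :: ennreal) = ennreal (1/2)" using divide_ennreal[of 1 2] by simp
  have cond: "0 < emeasure (weighted_measure Y) A \<and> emeasure (weighted_measure Y) A \<le> 1/2 * emeasure (weighted_measure Y) (space (weighted_measure Y))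
      \<longleftrightarrow> 0 < measure (weighted_measure Y) A \<and> measure (weighted_measure Y) A \<le> 1/2 * measure (weighted_measure Y) Y" for A
    using rb(3) by (simp only: half space_weighted_measure W.emeasure_eq_measure ennreal_less_zero_iff
        ennreal_mult[symmetric] measure_nonneg) simp
  have "ennreal c \<le> ennreal (enn2real (flow Y A) / measure (weighted_measure Y) A)
      \<longleftrightarrow> c * measure (weighted_measure Y) A \<le> enn2real (flow Y A)" if "0 < measure (weighted_measure Y) A" for A
    using that by (simp add: pos_le_divide_eq)
  then have "ennreal c \<le> 1 / emeasure (weighted_measure Y) A *
        (\<integral>\<^sup>+x\<in>A. ennreal (1 / weight Y x * jump Y x (space (weighted_measure Y) - A)) \<partial>weighted_measure Y)
      \<longleftrightarrow> c * measure (weighted_measure Y) A \<le> enn2real (flow Y A)"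
    if "A \<in> sets M" "A \<subseteq> Y" "0 < measure (weighted_measure Y) A" for A
    unfolding cheeger_term[OF rb that] using that(3) by simp
  then show ?thesis
    unfolding cheeger_constant_def markov_expands_def le_INF_iff mem_Collect_eq Ball_def cond
      sets_weighted_measure_iff[OF rb(3)]
    by blast
qed

end

section \<open>From groupoids to partial maps\<close>

text \<open>Multiplying by a unit changes nothing, so the product only selects arrows by their source.\<close>

lemma rng_image_set_gmult:
  assumes "groupoid G" "K \<subseteq> arrows G" "A \<subseteq> units G"
  shows "rng G ` set_gmult G K A = {rng G a | a. a \<in> K \<and> src G a \<in> A}"
proof -
  interpret groupoid G by fact
  have eq: "src G a = b" "gmult G a b = a" if "a \<in> K" "b \<in> A" "src G a = rng G b" for a b
  proof -
    have "b \<in> units G" "a \<in> arrows G" using that assms(2,3) by auto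
    then show "src G a = b" "gmult G a b = a"
      using that(3) rng_unit[of b] gmult_src[of a] by auto
  qed
  have unit: "rng G (src G a) = src G a" if "src G a \<in> A" for a
    using that assms(3) rng_unit by blast
  show ?thesis
  proof (intro subset_antisym subsetI)
    fix x assume "x \<in> rng G ` set_gmult G K A"
    then obtain a b where "a \<in> K" "b \<in> A" "src G a = rng G b" "x = rng G (gmult G a b)"
      unfolding set_gmult_def by blast
    then show "x \<in> {rng G a | a. a \<in> K \<and> src G a \<in> A}"
      using eq[of a b] by auto
  next
    fix x assume "x \<in> {rng G a | a. a \<in> K \<and> src G a \<in> A}"
    then obtain a where a: "a \<in> K" "src G a \<in> A" "x = rng G a" by blast
    then have "a \<in> set_gmult G K A"
      unfolding set_gmult_def using eq(2)[of a "src G a"] unit[of a] by force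
    then show "x \<in> rng G ` set_gmult G K A" using a(3) by blast
  qed
qed

lemma tau_ginv:
  assumes "groupoid G" "bisection G K" "bisection G K'" "ginv G ` K = K'" "x \<in> src G ` K"
  shows "tau G K x \<in> src G ` K'" and "tau G K' (tau G K x) = x"
proof -
  interpret groupoid G by fact
  obtain a where a: "a \<in> K" "x = src G a" using assms(5) by auto
  have "a \<in> arrows G" using a(1) assms(2) by (auto simp: bisection_def)
  moreover have "ginv G a \<in> K'" using a(1) assms(4) by auto
  ultimately show "tau G K x \<in> src G ` K'" "tau G K' (tau G K x) = x"
    using tau_src[OF assms(2) a(1)] tau_src[OF assms(3) \<open>ginv G a \<in> K'\<close>] a(2)
      src_ginv[of a] rng_ginv[of a] by (auto simp: image_iff intro!: bexI[of _ "ginv G a"])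
qed

lemma tau_units:
  assumes "groupoid G" "bisection G (units G)" "x \<in> units G"
  shows "tau G (units G) x = x"
  using tau_src[OF assms(2,3)] groupoid.src_unit[OF assms(1,3)] groupoid.rng_unit[OF assms(1,3)]
  by simp

text \<open>
  The index permutation of a symmetric decomposition supplies the inverse maps, and the member
  equal to the unit space supplies the identity.
\<close>

locale measured_decomposition = groupoid G + prob_space M
  for G :: "'g groupoid" and M :: "'g measure" +
  fixes l :: "'g \<Rightarrow> real" and N :: nat and K :: "'g set" and Ks :: "nat \<Rightarrow> 'g set"
  assumes space_M: "space M = units G"
    and dec: "unital_symmetric_decomposition G l M N K Ks"
begin

lemma Ks_admissible: "i \<in> {1..N} \<Longrightarrow> admissible G l M (Ks i)"
  using dec by (auto simp: unital_symmetric_decomposition_def decomposition_def)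

lemma Ks_bisection: "i \<in> {1..N} \<Longrightarrow> bisection G (Ks i)"
  using Ks_admissible by (auto simp: admissible_def)

sublocale partial_transports M N "\<lambda>i. src G ` Ks i" "\<lambda>i. tau G (Ks i)" "\<lambda>i. RN_ratio G M (Ks i)"
proof
  have fin: "finite_measure M" by (rule finite_measure_axioms)
  show "src G ` Ks i \<in> sets M" if "i \<in> {1..N}" for i
    using Ks_admissible[OF that] by (simp add: admissible_def)
  show "tau G (Ks i) ` S \<in> sets M" if "i \<in> {1..N}" "S \<in> sets M" "S \<subseteq> src G ` Ks i" for i S
    by (rule tau_image_sets[OF Ks_admissible[OF that(1)] that(2,3)])
  show "{x \<in> src G ` Ks i. tau G (Ks i) x \<in> B} \<in> sets M" if "i \<in> {1..N}" "B \<in> sets M" for i B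
    by (rule sets_vimage_tau[OF Ks_admissible[OF that(1)] that(2)])
  show "0 < RN_ratio G M (Ks i) x" for i x by (rule RN_ratio_pos)
  show "RN_ratio G M (Ks i) \<in> borel_measurable (restrict_space M (src G ` Ks i))"
    if "i \<in> {1..N}" for i
    by (rule RN_ratio_measurable_and_integral(1)[OF fin Ks_admissible[OF that]])
  show "emeasure M (tau G (Ks i) ` S) = (\<integral>\<^sup>+x\<in>S. ennreal (RN_ratio G M (Ks i) x) \<partial>M)"
    if "i \<in> {1..N}" "S \<in> sets M" "S \<subseteq> src G ` Ks i" for i S
    by (rule RN_ratio_measurable_and_integral(2)[OF fin Ks_admissible[OF that(1)] that(2,3)])
  show "\<exists>j\<in>{1..N}. \<forall>x\<in>src G ` Ks i. tau G (Ks i) x \<in> src G ` Ks j \<and> tau G (Ks j) (tau G (Ks i) x) = x"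
    if i: "i \<in> {1..N}" for i
  proof -
    obtain \<sigma> where "bij_betw \<sigma> {1..N} {1..N}" "ginv G ` Ks i = Ks (\<sigma> i)"
      using dec i by (auto simp: unital_symmetric_decomposition_def symmetric_decomp_def)
    then have j: "\<sigma> i \<in> {1..N}" and eq: "ginv G ` Ks i = Ks (\<sigma> i)"
      using i bij_betwE by blast+
    show ?thesis
      using tau_ginv[OF groupoid_axioms Ks_bisection[OF i] Ks_bisection[OF j] eq] j by blast
  qed
  show "\<exists>i\<in>{1..N}. src G ` Ks i = space M \<and> (\<forall>x\<in>space M. tau G (Ks i) x = x)"
  proof -
    obtain i where i: "i \<in> {1..N}" "Ks i = units G"
      using dec by (auto simp: unital_symmetric_decomposition_def unital_decomp_def)
    moreover have "src G ` units G = units G" using src_unit by force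
    moreover have "tau G (units G) x = x" if "x \<in> units G" for x
      using tau_units[OF groupoid_axioms _ that] Ks_bisection[OF i(1)] i(2) by simp
    ultimately show ?thesis using space_M by (intro bexI[of _ i]) auto
  qed
qed

lemma reach_eq:
  assumes "A \<in> sets M"
  shows "rng G ` set_gmult G K A = reach A"
proof -
  have K: "K = (\<Union>i\<in>{1..N}. Ks i)"
    using dec by (auto simp: unital_symmetric_decomposition_def decomposition_def)
  moreover have "Ks i \<subseteq> arrows G" if "i \<in> {1..N}" for i
    using Ks_bisection[OF that] by (simp add: bisection_def)
  ultimately have "K \<subseteq> arrows G" by blast
  then have "rng G ` set_gmult G K A = {rng G a | a. a \<in> K \<and> src G a \<in> A}"
    using sets.sets_into_space[OF assms] space_M
    by (intro rng_image_set_gmult groupoid_axioms) auto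
  also have "\<dots> = (\<Union>i\<in>{1..N}. {rng G a | a. a \<in> Ks i \<and> src G a \<in> A})"
    unfolding K by blast
  also have "\<dots> = reach A"
    unfolding reach_def
  proof (rule SUP_cong[OF refl])
    fix i assume "i \<in> {1..N}"
    have "{rng G a | a. a \<in> Ks i \<and> src G a \<in> A} = rng G ` {a \<in> Ks i. src G a \<in> A}" by blast
    also have "\<dots> = tau G (Ks i) ` src G ` {a \<in> Ks i. src G a \<in> A}"
      unfolding image_image
      by (rule image_cong) (simp_all add: tau_src[OF Ks_bisection[OF \<open>i \<in> {1..N}\<close>]])
    also have "src G ` {a \<in> Ks i. src G a \<in> A} = A \<inter> src G ` Ks i" by blast
    finally show "{rng G a | a. a \<in> Ks i \<and> src G a \<in> A} = tau G (Ks i) ` (A \<inter> src G ` Ks i)" .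
  qed
  finally show ?thesis .
qed

lemma expands_iff:
  "expands Y C \<longleftrightarrow> (\<forall>A\<in>sets M. A \<subseteq> Y \<and> 0 < measure M A \<and> measure M A \<le> 1/2 * measure M Y \<longrightarrow>
     measure M ((rng G ` set_gmult G K A - A) \<inter> Y) > C * measure M A)"
  by (simp add: expands_def boundary_def reach_eq)

lemma ratio_bounded_iff: "ratio_bounded G M N Ks Y \<theta> \<longleftrightarrow> ratio_bound Y \<theta>"
  by (simp only: ratio_bounded_def ratio_bound_def)

lemma reversing_measure_eq: "reversing_measure G M N Ks Y = weighted_measure Y"
  by (simp only: reversing_measure_def weighted_measure_def local_weight_def local_indices_def weight_def)

lemma markov_kernel_eq:
  "markov_kernel G M N Ks Y = (\<lambda>x B. ennreal (1 / weight Y x * jump Y x B))"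
  by (simp only: markov_kernel_def[abs_def] local_weight_def local_indices_def weight_def jump_def)

end

section \<open>The three conditions\<close>

text \<open>
  The set \<open>Y\<close> and its decomposition stay the same. The constant is halved because a Markov domain
  requires the Cheeger constant to exceed it strictly.
\<close>

lemma domain_of_expansion_imp_markov:
  assumes "groupoid G" "prob_space M" "space M = units G" and C: "0 < C" and \<theta>: "1 \<le> \<theta>"
    and dom: "domain_of_expansion G l M Y C N L \<theta>"
  shows "\<exists>C'>0. domain_of_markov_expansion G l M Y C' N L \<theta>"
proof -
  from dom obtain K Ks where Y: "Y \<in> sets M"
    and K: "n_decomposable G l M N K" "set_length l K \<le> ennreal L"
      "unital_symmetric_decomposition G l M N K Ks" "ratio_bounded G M N Ks Y \<theta>"
    and ex: "\<forall>A\<in>sets M. A \<subseteq> Y \<and> 0 < measure M A \<and> measure M A \<le> 1/2 * measure M Y \<longrightarrow>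
        measure M ((rng G ` set_gmult G K A - A) \<inter> Y) > C * measure M A"
    unfolding domain_of_expansion_def by blast
  interpret measured_decomposition G M l N K Ks
    using assms(1-3) K(3) by (intro measured_decomposition.intro measured_decomposition_axioms.intro)
  define c where "c = C / (real N ^ 2 * \<theta> ^ 3)"
  have c: "0 < c" using C \<theta> N_pos by (simp add: c_def)
  have "ratio_bound Y \<theta>" using K(4) by (simp only: ratio_bounded_iff)
  then have "ennreal c \<le> cheeger_constant (reversing_measure G M N Ks Y) (markov_kernel G M N Ks Y)"
    unfolding reversing_measure_eq markov_kernel_eq c_def
    using \<theta> Y C ex c c_def
    by (subst le_cheeger_constant_iff) (auto intro!: expands_imp_markov_expands simp: expands_iff)
  moreover have "ennreal (c / 2) < ennreal c" using c by (intro ennreal_lessI) auto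
  ultimately have "domain_of_markov_expansion G l M Y (c / 2) N L \<theta>"
    unfolding domain_of_markov_expansion_def using Y K by (meson less_le_trans)
  then show ?thesis using c by (intro exI[of _ "c / 2"]) simp
qed

lemma domain_of_markov_expansion_imp_expansion:
  assumes "groupoid G" "prob_space M" "space M = units G" and C: "0 < C" and \<theta>: "1 \<le> \<theta>"
    and dom: "domain_of_markov_expansion G l M Y C N L \<theta>"
  shows "\<exists>C'>0. domain_of_expansion G l M Y C' N L \<theta>"
proof -
  from dom obtain K Ks where Y: "Y \<in> sets M"
    and K: "n_decomposable G l M N K" "set_length l K \<le> ennreal L"
      "unital_symmetric_decomposition G l M N K Ks" "ratio_bounded G M N Ks Y \<theta>"
    and ch: "cheeger_constant (reversing_measure G M N Ks Y) (markov_kernel G M N Ks Y) > ennreal C"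
    unfolding domain_of_markov_expansion_def by blast
  interpret measured_decomposition G M l N K Ks
    using assms(1-3) K(3) by (intro measured_decomposition.intro measured_decomposition_axioms.intro)
  define c where "c = C / (2 * real N ^ 2 * \<theta> ^ 3)"
  have c: "0 < c" using C \<theta> N_pos by (simp add: c_def)
  have rb: "ratio_bound Y \<theta>" using K(4) by (simp only: ratio_bounded_iff)
  have "markov_expands Y C"
    using ch le_cheeger_constant_iff[OF rb \<theta> Y, of C] C
    by (simp add: reversing_measure_eq markov_kernel_eq less_imp_le)
  then have "expands Y c"
    unfolding c_def by (intro markov_expands_imp_expands rb \<theta> Y C)
  then have "domain_of_expansion G l M Y c N L \<theta>"
    unfolding domain_of_expansion_def expands_iff using Y K by blast
  then show ?thesis using c by blast
qed

text \<open>
  A single scale \<open>\<alpha>\<close> already produces a domain missing at most \<open>2 \<alpha>\<close>: one \<open>\<alpha>\<close> pays for bounding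
  the ratio, the other for the maximal badly expanding set.
\<close>

lemma asymptotically_expanding_imp_domain:
  assumes "groupoid G" "prob_space M" "space M = units G"
    and asym: "asymptotically_expanding G l M" and \<alpha>: "0 < \<alpha>" "\<alpha> \<le> 1/4"
  shows "\<exists>Y C N L \<theta>. Y \<in> sets M \<and> 1 - 2 * \<alpha> \<le> measure M Y \<and>
    C > 0 \<and> N > 0 \<and> L > 0 \<and> \<theta> \<ge> 1 \<and> domain_of_expansion G l M Y C N L \<theta>"
proof -
  have "0 < \<alpha> \<and> \<alpha> \<le> 1/2" using \<alpha> by simp
  from asym[unfolded asymptotically_expanding_def, THEN spec, THEN mp, OF this]
  obtain C N L K where C: "0 < C" "0 < N" "0 < L"
    and K: "n_decomposable G l M N K" "set_length l K \<le> ennreal L"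
    and ex: "\<forall>A\<in>sets M. \<alpha> \<le> measure M A \<and> measure M A \<le> 1/2 \<longrightarrow>
        measure M (rng G ` set_gmult G K A - A) > C * measure M A"
    by blast
  obtain Ks where Ks: "unital_symmetric_decomposition G l M N K Ks"
    using K(1) unfolding n_decomposable_def by blast
  interpret measured_decomposition G M l N K Ks
    using assms(1-3) Ks by (intro measured_decomposition.intro measured_decomposition_axioms.intro)
  \<comment> \<open>The part \<open>C * \<alpha> / 2\<close> is at most half of the expansion of any set of measure at least \<open>\<alpha>\<close>,
    so discarding a set of measure \<open>\<delta>\<close> leaves the other half.\<close>
  define \<delta> where "\<delta> = min \<alpha> (C * \<alpha> / 2)"
  have "0 < \<delta>" using \<alpha> C by (simp add: \<delta>_def)
  then obtain X \<theta> where X: "X \<in> sets M" "1 - \<delta> < measure M X" and \<theta>: "1 \<le> \<theta>" and rb: "ratio_bound X \<theta>"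
    using exists_ratio_bound by metis
  have mid: "C / 2 * measure M A < measure M (boundary X A)"
    if A: "A \<in> sets M" "\<alpha> \<le> measure M A" "measure M A \<le> 1/2" for A
  proof -
    have "C * measure M A < measure M (reach A - A)"
      using ex A reach_eq[OF A(1)] by auto
    also have "\<dots> \<le> measure M (boundary X A \<union> (space M - X))"
      using A(1) X(1) sets.sets_into_space[OF reach_sets[OF A(1)]]
      by (intro finite_measure_mono) (auto simp: boundary_def)
    also have "\<dots> \<le> measure M (boundary X A) + measure M (space M - X)"
      using A(1) X(1) by (intro measure_Un_le) auto
    also have "measure M (space M - X) = 1 - measure M X" by (rule prob_compl[OF X(1)])
    finally have "C * measure M A - C * \<alpha> / 2 < measure M (boundary X A)"
      using X(2) by (simp add: \<delta>_def min_def split: if_splits)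
    moreover have "C * \<alpha> / 2 \<le> C * measure M A / 2" using A(2) C by simp
    ultimately show ?thesis by simp
  qed
  have large: "1/2 + \<alpha> \<le> measure M X" using X(2) \<alpha> by (simp add: \<delta>_def)
  have "0 < C / 2" using C by simp
  from exists_expanding_subset[OF rb \<theta> X(1) this \<alpha> large mid]
  obtain Y where Y: "Y \<in> sets M" "Y \<subseteq> X" "measure M X - \<alpha> \<le> measure M Y"
      "expands Y (C / 2 / (4 * real N * \<theta>))"
    by blast
  let ?c = "C / 2 / (4 * real N * \<theta>)"
  have "ratio_bounded G M N Ks Y \<theta>"
    unfolding ratio_bounded_iff by (rule ratio_bound_subset[OF rb Y(2)])
  then have "domain_of_expansion G l M Y ?c N L \<theta>"
    unfolding domain_of_expansion_def
    using Y(1) K Ks Y(4)[unfolded expands_iff] by (intro conjI exI[of _ K] exI[of _ Ks])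
  moreover have "0 < ?c" using C \<theta> by simp
  moreover have "1 - 2 * \<alpha> \<le> measure M Y" using Y(3) X(2) by (simp add: \<delta>_def)
  ultimately show ?thesis using Y(1) C \<theta> by blast
qed

lemma domains_imp_asymptotically_expanding:
  assumes "groupoid G" "prob_space M" "space M = units G"
    and ex: "\<And>\<epsilon>. 0 < \<epsilon> \<Longrightarrow> \<exists>Y C N L \<theta>. 1 - \<epsilon> < measure M Y \<and>
      C > 0 \<and> N > 0 \<and> L > 0 \<and> \<theta> \<ge> 1 \<and> domain_of_expansion G l M Y C N L \<theta>"
  shows "asymptotically_expanding G l M"
  unfolding asymptotically_expanding_def
proof (intro allI impI)
  fix \<alpha> :: real assume \<alpha>: "0 < \<alpha> \<and> \<alpha> \<le> 1/2"
  then obtain Y C N L \<theta> where muY: "1 - \<alpha> / 2 < measure M Y"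
    and C: "0 < C" "0 < N" "0 < L" "1 \<le> \<theta>" and dom: "domain_of_expansion G l M Y C N L \<theta>"
    using ex[of "\<alpha> / 2"] by auto
  from dom obtain K Ks where Y: "Y \<in> sets M"
    and K: "n_decomposable G l M N K" "set_length l K \<le> ennreal L"
      "unital_symmetric_decomposition G l M N K Ks" "ratio_bounded G M N Ks Y \<theta>"
    and exp: "\<forall>A\<in>sets M. A \<subseteq> Y \<and> 0 < measure M A \<and> measure M A \<le> 1/2 * measure M Y \<longrightarrow>
        measure M ((rng G ` set_gmult G K A - A) \<inter> Y) > C * measure M A"
    unfolding domain_of_expansion_def by blast
  interpret measured_decomposition G M l N K Ks
    using assms(1-3) K(3) by (intro measured_decomposition.intro measured_decomposition_axioms.intro)
  have rb: "ratio_bound Y \<theta>" using K(4) by (simp only: ratio_bounded_iff)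
  have eY: "expands Y C" using exp by (simp only: expands_iff)
  have "\<forall>A\<in>sets M. \<alpha> \<le> measure M A \<and> measure M A \<le> 1/2 \<longrightarrow>
      measure M (rng G ` set_gmult G K A - A) > C / (2 * real N * \<theta>) * measure M A"
    using expands_imp_reach_gt[OF rb C(4) Y eY C(1) _ muY] \<alpha> reach_eq by auto
  moreover have "0 < C / (2 * real N * \<theta>)" using C by simp
  ultimately show "\<exists>C N L K. 0 < C \<and> 0 < N \<and> 0 < L \<and> n_decomposable G l M N K \<and>
      set_length l K \<le> ennreal L \<and>
      (\<forall>A\<in>sets M. \<alpha> \<le> measure M A \<and> measure M A \<le> 1/2 \<longrightarrow>
        measure M (rng G ` set_gmult G K A - A) > C * measure M A)"
    using C K by blast
qed

theorem theorem2:
  fixes G :: "'g groupoid" and l :: "'g \<Rightarrow> real" and M :: "'g measure"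
  assumes "groupoid G"
    and "length_function G l"
    and "prob_space M"
    and "space M = units G"
  shows "(asymptotically_expanding G l M \<longleftrightarrow>
      (\<exists>(Y :: nat \<Rightarrow> 'g set) (C :: nat \<Rightarrow> real) (N :: nat \<Rightarrow> nat) (L :: nat \<Rightarrow> real) (\<theta> :: nat \<Rightarrow> real).
        (\<forall>n. Y n \<in> sets M) \<and> (\<lambda>n. measure M (Y n)) \<longlonglongrightarrow> 1 \<and>
        (\<forall>n. C n > 0 \<and> N n > 0 \<and> L n > 0 \<and> \<theta> n \<ge> 1 \<and>
          domain_of_expansion G l M (Y n) (C n) (N n) (L n) (\<theta> n)))) \<and>
    (asymptotically_expanding G l M \<longleftrightarrow>
      (\<exists>(Y :: nat \<Rightarrow> 'g set) (C :: nat \<Rightarrow> real) (N :: nat \<Rightarrow> nat) (L :: nat \<Rightarrow> real) (\<theta> :: nat \<Rightarrow> real).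
        (\<forall>n. Y n \<in> sets M) \<and> (\<lambda>n. measure M (Y n)) \<longlonglongrightarrow> 1 \<and>
        (\<forall>n. C n > 0 \<and> N n > 0 \<and> L n > 0 \<and> \<theta> n \<ge> 1 \<and>
          domain_of_markov_expansion G l M (Y n) (C n) (N n) (L n) (\<theta> n))))"
    (is "(?asym \<longleftrightarrow> ?exh) \<and> (?asym \<longleftrightarrow> ?mexh)")
proof -
  note space = assms(1,3,4)
  interpret prob_space M by fact
  have "?exh" if ?asym
  proof -
    define \<alpha> where "\<alpha> n = 1 / real (n + 4)" for n
    have \<alpha>: "0 < \<alpha> n" "\<alpha> n \<le> 1/4" for n by (simp_all add: \<alpha>_def field_simps)
    have "\<forall>n. \<exists>Y C N L \<theta>. Y \<in> sets M \<and> 1 - 2 * \<alpha> n \<le> measure M Y \<and>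
        C > 0 \<and> N > 0 \<and> L > 0 \<and> \<theta> \<ge> 1 \<and> domain_of_expansion G l M Y C N L \<theta>"
      using asymptotically_expanding_imp_domain[OF space that \<alpha>] by blast
    then obtain Y C N L \<theta> where *: "\<And>n. Y n \<in> sets M \<and> 1 - 2 * \<alpha> n \<le> measure M (Y n) \<and>
        C n > 0 \<and> N n > 0 \<and> L n > 0 \<and> \<theta> n \<ge> 1 \<and>
        domain_of_expansion G l M (Y n) (C n) (N n) (L n) (\<theta> n)"
      unfolding choice_iff by blast
    have "\<alpha> \<longlonglongrightarrow> 0"
      unfolding \<alpha>_def using LIMSEQ_ignore_initial_segment[OF lim_1_over_n, of 4] by simp
    then have "(\<lambda>n. 1 - 2 * \<alpha> n) \<longlonglongrightarrow> 1 - 2 * 0" by (intro tendsto_intros)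
    then have lower: "(\<lambda>n. 1 - 2 * \<alpha> n) \<longlonglongrightarrow> 1" by simp
    have "(\<lambda>n. measure M (Y n)) \<longlonglongrightarrow> 1"
      by (rule tendsto_sandwich[OF _ _ lower tendsto_const]) (simp_all add: *)
    then show ?exh using * by blast
  qed
  moreover have ?asym if ?exh
  proof (rule domains_imp_asymptotically_expanding[OF space])
    from that obtain Y C N L \<theta> where lim: "(\<lambda>n. measure M (Y n)) \<longlonglongrightarrow> 1"
      and *: "\<And>n. C n > 0 \<and> N n > 0 \<and> L n > 0 \<and> \<theta> n \<ge> 1 \<and>
        domain_of_expansion G l M (Y n) (C n) (N n) (L n) (\<theta> n)"
      by blast
    fix \<epsilon> :: real assume "0 < \<epsilon>"
    then have "eventually (\<lambda>n. 1 - \<epsilon> < measure M (Y n)) sequentially"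
      by (intro order_tendstoD(1)[OF lim]) simp
    then obtain n where "1 - \<epsilon> < measure M (Y n)" by (auto simp: eventually_sequentially)
    then show "\<exists>Y C N L \<theta>. 1 - \<epsilon> < measure M Y \<and>
        C > 0 \<and> N > 0 \<and> L > 0 \<and> \<theta> \<ge> 1 \<and> domain_of_expansion G l M Y C N L \<theta>"
      using * by blast
  qed
  moreover have ?mexh if exh: ?exh
  proof -
    from exh obtain Y C N L \<theta> where Y: "\<forall>n. Y n \<in> sets M" "(\<lambda>n. measure M (Y n)) \<longlonglongrightarrow> 1"
      and *: "\<And>n. C n > 0 \<and> N n > 0 \<and> L n > 0 \<and> \<theta> n \<ge> 1 \<and>
        domain_of_expansion G l M (Y n) (C n) (N n) (L n) (\<theta> n)"
      by blast
    then have "\<forall>n. \<exists>C'>0. domain_of_markov_expansion G l M (Y n) C' (N n) (L n) (\<theta> n)"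
      using domain_of_expansion_imp_markov[OF space] by blast
    then obtain C' where "\<And>n. C' n > 0 \<and> domain_of_markov_expansion G l M (Y n) (C' n) (N n) (L n) (\<theta> n)"
      unfolding choice_iff by blast
    then show ?mexh using Y * by blast
  qed
  moreover have ?exh if mexh: ?mexh
  proof -
    from mexh obtain Y C N L \<theta> where Y: "\<forall>n. Y n \<in> sets M" "(\<lambda>n. measure M (Y n)) \<longlonglongrightarrow> 1"
      and *: "\<And>n. C n > 0 \<and> N n > 0 \<and> L n > 0 \<and> \<theta> n \<ge> 1 \<and>
        domain_of_markov_expansion G l M (Y n) (C n) (N n) (L n) (\<theta> n)"
      by blast
    then have "\<forall>n. \<exists>C'>0. domain_of_expansion G l M (Y n) C' (N n) (L n) (\<theta> n)"
      using domain_of_markov_expansion_imp_expansion[OF space] by blast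
    then obtain C' where "\<And>n. C' n > 0 \<and> domain_of_expansion G l M (Y n) (C' n) (N n) (L n) (\<theta> n)"
      unfolding choice_iff by blast
    then show ?exh using Y * by blast
  qed
  ultimately show ?thesis by blast
qed

end
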